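(* Let $X=N+A$ be a process of class $(\Sigma D)$, and define $\lambda(x)=\mathbb{E}[X_\infty\mid A_\infty=x]$. Assume that $\lambda(A_\infty)\neq 0$ almost surely. Let $b=\inf\{u:\ \mathbb{P}(A_\infty\ge u)=0\}$. Then, for $0\le x<b$, $$\mathbb{P}(A_\infty>x)=\exp\left(-\int_0^x\frac{dz}{\lambda(z)}\right).$$
   Context: All processes are defined on a filtered probability space satisfying the usual conditions; "increasing" means nondecreasing. A nonnegative local submartingale $X$ with decomposition $X_t=N_t+A_t$ is of class $(\Sigma)$ if: (i) $(N_t)$ is a càdlàg local martingale with $N_0=0$; (ii) $(A_t)$ is a continuous adapted increasing process with $A_0=0$; (iii) the measure $(dA_t)$ is carried by the set $\{t: X_t=0\}$. It is of class $(\Sigma D)$ if in addition it is of class $(D)$, i.e. $\{X_T: T \text{ a finite stopping time}\}$ is uniformly integrable. $X_\infty=\lim_{t\to\infty}X_t$ and $A_\infty=\lim_{t\to\infty}A_t$, which exist a.s. Convention: $\inf\emptyset=\infty$. *)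

theory Defs
  imports "HOL-Probability.Probability"
begin

text \<open>
  Time is \<open>[0,\<infinity>)\<close>. Filtrations and processes are indexed by \<^typ>\<open>real\<close>, and only their values
  at nonnegative indices ever matter; the library notion of a filtration is used for the
  constant extension to the left of 0. Path properties are required almost surely.
\<close>

definition usual_filtered_space :: "'a measure \<Rightarrow> (real \<Rightarrow> 'a measure) \<Rightarrow> bool" where
  "usual_filtered_space M F \<longleftrightarrow>
     prob_space M \<and> complete_measure M \<and>
     filtration (space M) (\<lambda>t. F (max 0 t)) \<and>
     (\<forall>t\<ge>0. subalgebra M (F t)) \<and>
     null_sets M \<subseteq> sets (F 0) \<and>
     (\<forall>t\<ge>0. sets (F t) = (\<Inter>s\<in>{t<..}. sets (F s)))"

definition adapted :: "(real \<Rightarrow> 'a measure) \<Rightarrow> (real \<Rightarrow> 'a \<Rightarrow> real) \<Rightarrow> bool" where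
  "adapted F X \<longleftrightarrow> (\<forall>t\<ge>0. X t \<in> borel_measurable (F t))"

definition cadlag :: "(real \<Rightarrow> real) \<Rightarrow> bool" where
  "cadlag f \<longleftrightarrow> (\<forall>t\<ge>0. (f \<longlongrightarrow> f t) (at_right t)) \<and> (\<forall>t>0. \<exists>l. (f \<longlongrightarrow> l) (at_left t))"

text \<open>
  The library's \<^const>\<open>stopping_time\<close> has values in the index type of the filtration;
  localising sequences need stopping times which may also take the value \<open>\<infinity>\<close>.
\<close>

definition ext_stopping_time :: "(real \<Rightarrow> 'a measure) \<Rightarrow> ('a \<Rightarrow> ennreal) \<Rightarrow> bool" where
  "ext_stopping_time F T \<longleftrightarrow> (\<forall>t\<ge>0. Measurable.pred (F t) (\<lambda>\<omega>. T \<omega> \<le> ennreal t))"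

definition stopped :: "(real \<Rightarrow> 'a \<Rightarrow> real) \<Rightarrow> ('a \<Rightarrow> ennreal) \<Rightarrow> real \<Rightarrow> 'a \<Rightarrow> real" where
  "stopped X T t \<omega> = X (enn2real (min (ennreal t) (T \<omega>))) \<omega>"

definition martingale ::
  "'a measure \<Rightarrow> (real \<Rightarrow> 'a measure) \<Rightarrow> (real \<Rightarrow> 'a \<Rightarrow> real) \<Rightarrow> bool" where
  "martingale M F X \<longleftrightarrow> adapted F X \<and> (\<forall>t\<ge>0. integrable M (X t)) \<and>
     (\<forall>s t. 0 \<le> s \<longrightarrow> s \<le> t \<longrightarrow> (AE \<omega> in M. real_cond_exp M (F s) (X t) \<omega> = X s \<omega>))"

definition submartingale ::
  "'a measure \<Rightarrow> (real \<Rightarrow> 'a measure) \<Rightarrow> (real \<Rightarrow> 'a \<Rightarrow> real) \<Rightarrow> bool" where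
  "submartingale M F X \<longleftrightarrow> adapted F X \<and> (\<forall>t\<ge>0. integrable M (X t)) \<and>
     (\<forall>s t. 0 \<le> s \<longrightarrow> s \<le> t \<longrightarrow> (AE \<omega> in M. X s \<omega> \<le> real_cond_exp M (F s) (X t) \<omega>))"

definition localising_sequence ::
  "'a measure \<Rightarrow> (real \<Rightarrow> 'a measure) \<Rightarrow> (nat \<Rightarrow> 'a \<Rightarrow> ennreal) \<Rightarrow> bool" where
  "localising_sequence M F T \<longleftrightarrow> (\<forall>n. ext_stopping_time F (T n)) \<and>
     (AE \<omega> in M. incseq (\<lambda>n. T n \<omega>) \<and> (\<lambda>n. T n \<omega>) \<longlonglongrightarrow> \<infinity>)"

text \<open>
  The initial value is subtracted before stopping, so that nothing is required of it beyond
  measurability; in class \<open>(\<Sigma>)\<close> all initial values vanish.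
\<close>

definition local_martingale ::
  "'a measure \<Rightarrow> (real \<Rightarrow> 'a measure) \<Rightarrow> (real \<Rightarrow> 'a \<Rightarrow> real) \<Rightarrow> bool" where
  "local_martingale M F X \<longleftrightarrow> adapted F X \<and> (AE \<omega> in M. cadlag (\<lambda>t. X t \<omega>)) \<and>
     (\<exists>T. localising_sequence M F T \<and>
        (\<forall>n. martingale M F (stopped (\<lambda>t \<omega>. X t \<omega> - X 0 \<omega>) (T n))))"

definition local_submartingale ::
  "'a measure \<Rightarrow> (real \<Rightarrow> 'a measure) \<Rightarrow> (real \<Rightarrow> 'a \<Rightarrow> real) \<Rightarrow> bool" where
  "local_submartingale M F X \<longleftrightarrow> adapted F X \<and> (AE \<omega> in M. cadlag (\<lambda>t. X t \<omega>)) \<and>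
     (\<exists>T. localising_sequence M F T \<and>
        (\<forall>n. submartingale M F (stopped (\<lambda>t \<omega>. X t \<omega> - X 0 \<omega>) (T n))))"

text \<open>
  The measure \<open>dA\<^sub>t(\<omega>)\<close> is the Stieltjes measure of the path of \<open>A\<close>, extended by \<open>A\<^sub>0(\<omega>)\<close>
  to the left of 0, so that it charges neither the negative half line nor (by continuity) 0.
\<close>

definition path_measure :: "(real \<Rightarrow> 'a \<Rightarrow> real) \<Rightarrow> 'a \<Rightarrow> real measure" where
  "path_measure A \<omega> = interval_measure (\<lambda>t. A (max 0 t) \<omega>)"

definition class_Sigma ::
  "'a measure \<Rightarrow> (real \<Rightarrow> 'a measure) \<Rightarrow>
   (real \<Rightarrow> 'a \<Rightarrow> real) \<Rightarrow> (real \<Rightarrow> 'a \<Rightarrow> real) \<Rightarrow> (real \<Rightarrow> 'a \<Rightarrow> real) \<Rightarrow> bool" where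
  "class_Sigma M F X N A \<longleftrightarrow>
     local_submartingale M F X \<and>
     (AE \<omega> in M. \<forall>t\<ge>0. 0 \<le> X t \<omega>) \<and>
     (AE \<omega> in M. \<forall>t\<ge>0. X t \<omega> = N t \<omega> + A t \<omega>) \<and>
     local_martingale M F N \<and> (AE \<omega> in M. N 0 \<omega> = 0) \<and>
     adapted F A \<and>
     (AE \<omega> in M. continuous_on {0..} (\<lambda>t. A t \<omega>) \<and> mono_on {0..} (\<lambda>t. A t \<omega>) \<and> A 0 \<omega> = 0) \<and>
     (AE \<omega> in M. AE t in path_measure A \<omega>. 0 \<le> t \<and> X t \<omega> = 0)"

definition uniformly_integrable :: "'a measure \<Rightarrow> ('a \<Rightarrow> real) set \<Rightarrow> bool" where
  "uniformly_integrable M \<Y> \<longleftrightarrow> \<Y> \<subseteq> borel_measurable M \<and>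
     ((\<lambda>c::real. SUP Y\<in>\<Y>. \<integral>\<^sup>+\<omega>. ennreal \<bar>Y \<omega>\<bar> * indicator {\<omega>. c < \<bar>Y \<omega>\<bar>} \<omega> \<partial>M) \<longlongrightarrow> 0) at_top"

definition class_D ::
  "'a measure \<Rightarrow> (real \<Rightarrow> 'a measure) \<Rightarrow> (real \<Rightarrow> 'a \<Rightarrow> real) \<Rightarrow> bool" where
  "class_D M F X \<longleftrightarrow>
     uniformly_integrable M
       {(\<lambda>\<omega>. X (enn2real (T \<omega>)) \<omega>) | T.
          ext_stopping_time F T \<and> (\<forall>\<omega>\<in>space M. T \<omega> < \<infinity>)}"

definition class_Sigma_D ::
  "'a measure \<Rightarrow> (real \<Rightarrow> 'a measure) \<Rightarrow>
   (real \<Rightarrow> 'a \<Rightarrow> real) \<Rightarrow> (real \<Rightarrow> 'a \<Rightarrow> real) \<Rightarrow> (real \<Rightarrow> 'a \<Rightarrow> real) \<Rightarrow> bool" where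
  "class_Sigma_D M F X N A \<longleftrightarrow> class_Sigma M F X N A \<and> class_D M F X"

text \<open>On the null set where the path does not converge, the value is an unspecified real.\<close>

definition terminal_value :: "(real \<Rightarrow> 'a \<Rightarrow> real) \<Rightarrow> 'a \<Rightarrow> real" where
  "terminal_value X \<omega> = Lim at_top (\<lambda>t. X t \<omega>)"

text \<open>
  \<open>l\<close> is a version of \<open>x \<mapsto> E[Y | Z = x]\<close>: a Borel function with \<open>E[Y | \<sigma>(Z)] = l(Z)\<close> almost surely.
  It is determined only up to null sets of the law of \<open>Z\<close>.
\<close>

definition cond_exp_given_value ::
  "'a measure \<Rightarrow> ('a \<Rightarrow> real) \<Rightarrow> ('a \<Rightarrow> real) \<Rightarrow> (real \<Rightarrow> real) \<Rightarrow> bool" where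
  "cond_exp_given_value M Y Z l \<longleftrightarrow> l \<in> borel_measurable borel \<and>
     (AE \<omega> in M. real_cond_exp M (vimage_algebra (space M) Z borel) Y \<omega> = l (Z \<omega>))"

text \<open>In the extended reals the infimum of the empty set is \<open>\<infinity>\<close>.\<close>

definition upper_end :: "'a measure \<Rightarrow> ('a \<Rightarrow> real) \<Rightarrow> ereal" where
  "upper_end M Z = Inf {ereal u | u. measure M {\<omega> \<in> space M. u \<le> Z \<omega>} = 0}"

end

theory Submission
  imports Defs
begin

text \<open>
  Let \<open>S\<close> be the first time at which \<open>A\<close> exceeds a level \<open>x\<close>, capped at \<open>t\<close>. The time \<open>S\<close> is a
  point of right increase of \<open>A\<close> when \<open>S < t\<close>, so that \<open>X\<^sub>S = 0\<close> there by right continuity,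
  and \<open>X\<^sub>S = X\<^sub>t\<close> otherwise; moreover \<open>A\<^sub>S\<close> is the minimum of \<open>A\<^sub>t\<close> and \<open>x\<close>. Optional stopping
  of \<open>N = X - A\<close> gives \<open>E[X\<^sub>S] = E[A\<^sub>S]\<close>, and \<open>t \<rightarrow> \<infinity>\<close> turns this into
  \<open>E[X\<^sub>\<infinity>; A\<^sub>\<infinity> \<le> x] = E[min A\<^sub>\<infinity> x]\<close>. Writing \<open>G\<close> for the survival function and \<open>\<mu>\<close> for the law
  of \<open>A\<^sub>\<infinity>\<close>, this says that \<open>\<lambda> d\<mu> = G dx\<close> on the half line, hence \<open>dG = - G / \<lambda> dx\<close>.

  The almost sure limit \<open>X\<^sub>\<infinity>\<close> exists by a stopping argument in place of upcrossings: \<open>E[X\<^sub>S - X\<^sub>T]\<close>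
  is nearly nonpositive for late bounded stopping times \<open>S\<close>, \<open>T\<close>, which is incompatible with
  oscillation across \<open>a < b\<close> on an event of positive probability, since such an event can be
  approximated by events of the filtration.
\<close>

text \<open>Everything is arranged around \<open>E[X_S] = E[A_S]\<close> rather than
  \<open>E[N_S] = 0\<close>: class (D) controls \<open>X\<close> at stopping times and monotonicity
  controls \<open>A\<close>, whereas the local martingale \<open>N\<close> comes with no
  integrability. In this form the identity passes both through the localising sequence and through
  the discretisation of a stopping time. Path properties hold only almost surely, so events and
  random variables defined by paths are handled up to null sets, which completeness absorbs. On the
  analytic side neither a density of the law of \<open>A_infty\<close> nor any regularity of
  \<lambda> is known in advance, and \<lambda> is fixed only up to null sets of that law. The
  equality of the measures \<lambda> d\<mu> and G dx cures both: as long as G > 0 it makes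
  {\<lambda> \<le> 0} Lebesgue null and gives \<mu> the density G / \<lambda>. The resulting
  equation for G has a kernel that is merely measurable, so it is solved by comparing increments
  over fine meshes instead of differentiating.\<close>

section \<open>Uniform integrability\<close>

text \<open>Preimages under \<open>f\<close> and \<open>g\<close> differ inside a null set, and
  every subset of a null set is measurable. This is how random variables built from almost sure path
  properties become measurable.\<close>

lemma (in complete_measure) measurable_AE_eq:
  assumes f: "f \<in> measurable M N" and g: "g \<in> space M \<rightarrow> space N" and ae: "AE \<omega> in M. f \<omega> = g \<omega>"
  shows "g \<in> measurable M N"
proof (rule measurableI)
  fix B assume B: "B \<in> sets N"
  have "f -` B \<inter> space M \<in> sets M" using f B by (rule measurable_sets)
  moreover have "g -` B \<inter> space M \<subseteq> space M" by auto
  ultimately show "g -` B \<inter> space M \<in> sets M"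
    by (rule in_sets_AE[rotated]) (use ae in \<open>eventually_elim, auto\<close>)
qed (use g in auto)

text \<open>The total function \<open>lim\<close> is measurable in any case and agrees with
  \<open>Z\<close> wherever the sequence converges to \<open>Z\<close>.\<close>

lemma (in complete_measure) borel_measurable_AE_limit:
  fixes Y :: "nat \<Rightarrow> 'a \<Rightarrow> real"
  assumes [measurable]: "\<And>j. Y j \<in> borel_measurable M"
    and "AE \<omega> in M. (\<lambda>j. Y j \<omega>) \<longlonglongrightarrow> Z \<omega>"
  shows "Z \<in> borel_measurable M"
proof (rule measurable_AE_eq)
  show "(\<lambda>\<omega>. lim (\<lambda>j. Y j \<omega>)) \<in> borel_measurable M" by measurable
  show "AE \<omega> in M. lim (\<lambda>j. Y j \<omega>) = Z \<omega>"
    using assms(2) by eventually_elim (rule limI)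
qed auto

lemma uniformly_integrable_tail:
  assumes "uniformly_integrable M \<Y>" "0 < e"
  shows "\<exists>c\<ge>0. \<forall>Y\<in>\<Y>.
    (\<integral>\<^sup>+\<omega>. ennreal \<bar>Y \<omega>\<bar> * indicator {\<omega>. c < \<bar>Y \<omega>\<bar>} \<omega> \<partial>M) \<le> ennreal e"
proof -
  have "\<forall>\<^sub>F c::real in at_top.
     (SUP Y\<in>\<Y>. \<integral>\<^sup>+\<omega>. ennreal \<bar>Y \<omega>\<bar> * indicator {\<omega>. c < \<bar>Y \<omega>\<bar>} \<omega> \<partial>M) < ennreal e"
    using assms unfolding uniformly_integrable_def by (intro order_tendstoD(2)[where y = 0]) simp_all
  then have "\<forall>\<^sub>F c::real in at_top. 0 \<le> c \<and>
     (SUP Y\<in>\<Y>. \<integral>\<^sup>+\<omega>. ennreal \<bar>Y \<omega>\<bar> * indicator {\<omega>. c < \<bar>Y \<omega>\<bar>} \<omega> \<partial>M) < ennreal e"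
    using eventually_ge_at_top[of "0::real"] by eventually_elim auto
  then obtain c :: real where c: "0 \<le> c"
    "(SUP Y\<in>\<Y>. \<integral>\<^sup>+\<omega>. ennreal \<bar>Y \<omega>\<bar> * indicator {\<omega>. c < \<bar>Y \<omega>\<bar>} \<omega> \<partial>M) < ennreal e"
    by (auto dest!: eventually_happens'[OF trivial_limit_at_top_linorder])
  have "(\<integral>\<^sup>+\<omega>. ennreal \<bar>Y \<omega>\<bar> * indicator {\<omega>. c < \<bar>Y \<omega>\<bar>} \<omega> \<partial>M) \<le> ennreal e"
    if "Y \<in> \<Y>" for Y
  proof -
    have "(\<integral>\<^sup>+\<omega>. ennreal \<bar>Y \<omega>\<bar> * indicator {\<omega>. c < \<bar>Y \<omega>\<bar>} \<omega> \<partial>M) \<le>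
      (SUP Y\<in>\<Y>. \<integral>\<^sup>+\<omega>. ennreal \<bar>Y \<omega>\<bar> * indicator {\<omega>. c < \<bar>Y \<omega>\<bar>} \<omega> \<partial>M)"
      using that by (rule SUP_upper)
    from le_less_trans[OF this c(2)] show ?thesis by (rule less_imp_le)
  qed
  with c(1) show ?thesis by blast
qed

context prob_space
begin

text \<open>Splitting at \<bar>Y\<bar> = c bounds the small values by c on \<open>D\<close> and the
  large ones by the uniform tail. Taking \<open>D\<close> the whole space gives boundedness of the
  means, taking \<open>D\<close> of small probability gives uniform absolute continuity.\<close>

lemma uniformly_integrable_set_bound:
  assumes UI: "uniformly_integrable M \<Y>" and e: "0 < e"
  shows "\<exists>c\<ge>0. \<forall>Y\<in>\<Y>. \<forall>D\<in>sets M.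
    (\<integral>\<^sup>+\<omega>. ennreal \<bar>Y \<omega>\<bar> * indicator D \<omega> \<partial>M) \<le> ennreal (c * prob D + e)"
proof -
  obtain c where c: "0 \<le> c"
    "\<And>Y. Y \<in> \<Y> \<Longrightarrow> (\<integral>\<^sup>+\<omega>. ennreal \<bar>Y \<omega>\<bar> * indicator {\<omega>. c < \<bar>Y \<omega>\<bar>} \<omega> \<partial>M) \<le> ennreal e"
    using uniformly_integrable_tail[OF UI e] by metis
  have "(\<integral>\<^sup>+\<omega>. ennreal \<bar>Y \<omega>\<bar> * indicator D \<omega> \<partial>M) \<le> ennreal (c * prob D + e)"
    if Y: "Y \<in> \<Y>" and [measurable]: "D \<in> sets M" for Y D
  proof -
    have [measurable]: "Y \<in> borel_measurable M" using UI Y by (auto simp: uniformly_integrable_def)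
    have "(\<integral>\<^sup>+\<omega>. ennreal \<bar>Y \<omega>\<bar> * indicator D \<omega> \<partial>M) \<le>
      (\<integral>\<^sup>+\<omega>. ennreal c * indicator D \<omega> + ennreal \<bar>Y \<omega>\<bar> * indicator {\<omega>. c < \<bar>Y \<omega>\<bar>} \<omega> \<partial>M)"
      by (intro nn_integral_mono) (auto split: split_indicator intro: ennreal_leI)
    also have "\<dots> = (\<integral>\<^sup>+\<omega>. ennreal c * indicator D \<omega> \<partial>M) +
        (\<integral>\<^sup>+\<omega>. ennreal \<bar>Y \<omega>\<bar> * indicator {\<omega>. c < \<bar>Y \<omega>\<bar>} \<omega> \<partial>M)"
      by (rule nn_integral_add) measurable
    also have "\<dots> \<le> ennreal c * emeasure M D + ennreal e"
      using c(2)[OF Y] by (intro add_mono) (simp_all add: nn_integral_cmult)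
    also have "\<dots> = ennreal (c * prob D + e)"
      unfolding emeasure_eq_measure ennreal_mult[OF c(1) measure_nonneg, symmetric]
      using c(1) e by (intro ennreal_plus[symmetric]) auto
    finally show ?thesis .
  qed
  with c(1) show ?thesis by blast
qed

lemma uniformly_integrable_bounded:
  assumes UI: "uniformly_integrable M \<Y>"
  shows "\<exists>c\<ge>0. \<forall>Y\<in>\<Y>. (\<integral>\<^sup>+\<omega>. ennreal \<bar>Y \<omega>\<bar> \<partial>M) \<le> ennreal c"
proof -
  obtain c where c: "0 \<le> c" "\<And>Y D. \<lbrakk>Y \<in> \<Y>; D \<in> sets M\<rbrakk> \<Longrightarrow>
      (\<integral>\<^sup>+\<omega>. ennreal \<bar>Y \<omega>\<bar> * indicator D \<omega> \<partial>M) \<le> ennreal (c * prob D + 1)"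
    using uniformly_integrable_set_bound[OF UI zero_less_one] by blast
  have "(\<integral>\<^sup>+\<omega>. ennreal \<bar>Y \<omega>\<bar> \<partial>M) \<le> ennreal (c + 1)" if "Y \<in> \<Y>" for Y
  proof -
    have "(\<integral>\<^sup>+\<omega>. ennreal \<bar>Y \<omega>\<bar> \<partial>M) = (\<integral>\<^sup>+\<omega>. ennreal \<bar>Y \<omega>\<bar> * indicator (space M) \<omega> \<partial>M)"
      by (intro nn_integral_cong) simp
    also have "\<dots> \<le> ennreal (c * prob (space M) + 1)" using that sets.top by (rule c(2))
    finally show ?thesis unfolding prob_space by simp
  qed
  with c(1) show ?thesis by (intro exI[of _ "c + 1"]) auto
qed

lemma uniformly_integrable_integrable:
  assumes UI: "uniformly_integrable M \<Y>" and Y: "Y \<in> \<Y>"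
  shows "integrable M Y"
proof (rule integrableI_bounded)
  show "Y \<in> borel_measurable M" using assms by (auto simp: uniformly_integrable_def)
  obtain c :: real where "\<And>Y. Y \<in> \<Y> \<Longrightarrow> (\<integral>\<^sup>+\<omega>. ennreal \<bar>Y \<omega>\<bar> \<partial>M) \<le> ennreal c"
    using uniformly_integrable_bounded[OF UI] by blast
  from this[OF Y] show "(\<integral>\<^sup>+\<omega>. ennreal (norm (Y \<omega>)) \<partial>M) < \<infinity>"
    unfolding real_norm_def by (rule le_less_trans) simp
qed

lemma uniformly_integrable_abs_cont:
  assumes UI: "uniformly_integrable M \<Y>" and e: "0 < e"
  shows "\<exists>d>0. \<forall>Y\<in>\<Y>. \<forall>D\<in>sets M. prob D < d \<longrightarrow> (\<integral>\<omega>. indicator D \<omega> * \<bar>Y \<omega>\<bar> \<partial>M) \<le> e"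
proof -
  obtain c where c: "0 \<le> c" "\<And>Y D. \<lbrakk>Y \<in> \<Y>; D \<in> sets M\<rbrakk> \<Longrightarrow>
      (\<integral>\<^sup>+\<omega>. ennreal \<bar>Y \<omega>\<bar> * indicator D \<omega> \<partial>M) \<le> ennreal (c * prob D + e / 2)"
    using uniformly_integrable_set_bound[OF UI half_gt_zero[OF e]] by blast
  \<comment> \<open>Dividing by c + 1 instead of c covers the case c = 0.\<close>
  define d where "d = e / (2 * (c + 1))"
  have d: "0 < d" "(c + 1) * d = e / 2" using e c(1) by (auto simp: d_def field_simps)
  have "(\<integral>\<omega>. indicator D \<omega> * \<bar>Y \<omega>\<bar> \<partial>M) \<le> e"
    if Y: "Y \<in> \<Y>" and D [measurable]: "D \<in> sets M" and "prob D < d" for Y D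
  proof -
    have [measurable]: "Y \<in> borel_measurable M" using UI Y by (auto simp: uniformly_integrable_def)
    have "(\<integral>\<omega>. indicator D \<omega> * \<bar>Y \<omega>\<bar> \<partial>M) =
        enn2real (\<integral>\<^sup>+\<omega>. ennreal (indicator D \<omega> * \<bar>Y \<omega>\<bar>) \<partial>M)"
      by (rule integral_eq_nn_integral) auto
    also have "(\<integral>\<^sup>+\<omega>. ennreal (indicator D \<omega> * \<bar>Y \<omega>\<bar>) \<partial>M) =
      (\<integral>\<^sup>+\<omega>. ennreal \<bar>Y \<omega>\<bar> * indicator D \<omega> \<partial>M)"
      by (intro nn_integral_cong) (auto split: split_indicator)
    also have "enn2real \<dots> \<le> enn2real (ennreal (c * prob D + e / 2))"
      by (rule enn2real_mono[OF c(2)[OF Y D]]) simp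
    also have "\<dots> = c * prob D + e / 2" using c(1) e by (intro enn2real_ennreal) simp
    also have "\<dots> \<le> (c + 1) * d + e / 2"
      using c(1) d(1) \<open>prob D < d\<close> by (intro add_right_mono mult_mono) auto
    also have "\<dots> = e" using d(2) by simp
    finally show ?thesis .
  qed
  with d(1) show ?thesis by blast
qed

text \<open>Vitali's theorem. Values are clamped to [-c, c]: the clamped integrals converge by
  dominated convergence, and the clamping error is uniformly small for the sequence and, by Fatou,
  for the limit as well.\<close>

lemma uniformly_integrable_limit:
  fixes Y :: "nat \<Rightarrow> 'a \<Rightarrow> real"
  assumes UI: "uniformly_integrable M \<Y>" and Y: "\<And>j. Y j \<in> \<Y>"
    and Z [measurable]: "Z \<in> borel_measurable M" and lim: "AE \<omega> in M. (\<lambda>j. Y j \<omega>) \<longlonglongrightarrow> Z \<omega>"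
  shows "integrable M Z" "(\<lambda>j. \<integral>\<omega>. Y j \<omega> \<partial>M) \<longlonglongrightarrow> (\<integral>\<omega>. Z \<omega> \<partial>M)"
proof -
  have [measurable]: "Y j \<in> borel_measurable M" for j
    using UI Y by (auto simp: uniformly_integrable_def)
  have Y_int: "integrable M (Y j)" for j using uniformly_integrable_integrable[OF UI Y] .
  obtain C :: real where C: "0 \<le> C" "\<And>Y. Y \<in> \<Y> \<Longrightarrow> (\<integral>\<^sup>+\<omega>. ennreal \<bar>Y \<omega>\<bar> \<partial>M) \<le> ennreal C"
    using uniformly_integrable_bounded[OF UI] by blast
  \<comment> \<open>Used with f the absolute value, for integrability of the limit, and with f the
    excess of \<bar>y\<bar> over c, for its tail.\<close>
  have fatou: "(\<integral>\<^sup>+\<omega>. ennreal (f (Z \<omega>)) \<partial>M) \<le> ennreal b"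
    if f: "continuous_on UNIV f" and b: "\<And>j. (\<integral>\<^sup>+\<omega>. ennreal (f (Y j \<omega>)) \<partial>M) \<le> ennreal b"
    for f :: "real \<Rightarrow> real" and b
  proof -
    have [measurable]: "f \<in> borel_measurable borel" using f by (rule borel_measurable_continuous_onI)
    have "(\<integral>\<^sup>+\<omega>. ennreal (f (Z \<omega>)) \<partial>M) = (\<integral>\<^sup>+\<omega>. liminf (\<lambda>j. ennreal (f (Y j \<omega>))) \<partial>M)"
    proof (rule nn_integral_cong_AE, use lim in eventually_elim)
      fix \<omega> assume "(\<lambda>j. Y j \<omega>) \<longlonglongrightarrow> Z \<omega>"
      then have "(\<lambda>j. ennreal (f (Y j \<omega>))) \<longlonglongrightarrow> ennreal (f (Z \<omega>))"
        by (intro tendsto_ennrealI continuous_on_tendsto_compose[OF f]) auto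
      then show "ennreal (f (Z \<omega>)) = liminf (\<lambda>j. ennreal (f (Y j \<omega>)))"
        by (simp add: lim_imp_Liminf)
    qed
    also have "\<dots> \<le> liminf (\<lambda>j. \<integral>\<^sup>+\<omega>. ennreal (f (Y j \<omega>)) \<partial>M)"
      by (rule nn_integral_liminf) measurable
    also have "\<dots> \<le> liminf (\<lambda>j::nat. ennreal b)" using b by (intro Liminf_mono) auto
    also have "\<dots> = ennreal b" by (rule Liminf_const) simp
    finally show ?thesis .
  qed
  show Z_int: "integrable M Z"
  proof (rule integrableI_bounded)
    have "(\<integral>\<^sup>+\<omega>. ennreal \<bar>Z \<omega>\<bar> \<partial>M) \<le> ennreal C"
      by (rule fatou) (use C(2) Y in \<open>auto intro!: continuous_intros\<close>)
    then show "(\<integral>\<^sup>+\<omega>. ennreal (norm (Z \<omega>)) \<partial>M) < \<infinity>"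
      unfolding real_norm_def by (rule le_less_trans) simp
  qed simp
  define clamp where "clamp c y = max (- c) (min c y)" for c y :: real
  have trunc: "\<bar>(\<integral>\<omega>. W \<omega> \<partial>M) - (\<integral>\<omega>. clamp c (W \<omega>) \<partial>M)\<bar> \<le> e"
    if W: "integrable M W" and tail: "(\<integral>\<^sup>+\<omega>. ennreal (max (\<bar>W \<omega>\<bar> - c) 0) \<partial>M) \<le> ennreal e" and c: "0 \<le> c" "0 \<le> e"
    for W c e
  proof -
    have [measurable]: "W \<in> borel_measurable M" using W by simp
    have eq: "\<bar>W \<omega> - clamp c (W \<omega>)\<bar> = max (\<bar>W \<omega>\<bar> - c) 0" for \<omega>
      using c(1) unfolding clamp_def by auto
    have cl: "integrable M (\<lambda>\<omega>. clamp c (W \<omega>))"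
      by (rule integrable_const_bound[where B = c]) (use c(1) in \<open>auto simp: clamp_def\<close>)
    have "\<bar>(\<integral>\<omega>. W \<omega> \<partial>M) - (\<integral>\<omega>. clamp c (W \<omega>) \<partial>M)\<bar> = \<bar>\<integral>\<omega>. W \<omega> - clamp c (W \<omega>) \<partial>M\<bar>"
      using W cl by simp
    also have "\<dots> \<le> (\<integral>\<omega>. \<bar>W \<omega> - clamp c (W \<omega>)\<bar> \<partial>M)" by (rule integral_abs_bound)
    also have "\<dots> = enn2real (\<integral>\<^sup>+\<omega>. ennreal (max (\<bar>W \<omega>\<bar> - c) 0) \<partial>M)"
      unfolding eq by (rule integral_eq_nn_integral) auto
    also have "\<dots> \<le> enn2real (ennreal e)" using tail by (intro enn2real_mono) auto
    finally show ?thesis using c(2) by simp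
  qed
  show "(\<lambda>j. \<integral>\<omega>. Y j \<omega> \<partial>M) \<longlonglongrightarrow> (\<integral>\<omega>. Z \<omega> \<partial>M)"
  proof (rule LIMSEQ_I)
    fix r :: real assume "0 < r"
    then have r: "0 < r / 4" by simp
    obtain c where c: "0 \<le> c" "\<And>Y. Y \<in> \<Y> \<Longrightarrow>
        (\<integral>\<^sup>+\<omega>. ennreal \<bar>Y \<omega>\<bar> * indicator {\<omega>. c < \<bar>Y \<omega>\<bar>} \<omega> \<partial>M) \<le> ennreal (r / 4)"
      using uniformly_integrable_tail[OF UI r] by metis
    \<comment> \<open>The excess over c is continuous in the value, unlike \<bar>y\<bar> cut off by
      the indicator of c < \<bar>y\<bar>, so its bound passes to \<open>Z\<close> by
      \<open>fatou\<close>.\<close>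
    have tail: "(\<integral>\<^sup>+\<omega>. ennreal (max (\<bar>Y j \<omega>\<bar> - c) 0) \<partial>M) \<le> ennreal (r / 4)" for j
    proof -
      have "(\<integral>\<^sup>+\<omega>. ennreal (max (\<bar>Y j \<omega>\<bar> - c) 0) \<partial>M) \<le>
        (\<integral>\<^sup>+\<omega>. ennreal \<bar>Y j \<omega>\<bar> * indicator {\<omega>. c < \<bar>Y j \<omega>\<bar>} \<omega> \<partial>M)"
        using c(1) by (intro nn_integral_mono) (auto split: split_indicator intro!: ennreal_leI simp: max_def ennreal_neg)
      also have "\<dots> \<le> ennreal (r / 4)" using c(2)[OF Y] .
      finally show ?thesis .
    qed
    have tailZ: "(\<integral>\<^sup>+\<omega>. ennreal (max (\<bar>Z \<omega>\<bar> - c) 0) \<partial>M) \<le> ennreal (r / 4)"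
      by (rule fatou[OF _ tail]) (intro continuous_intros)
    have "(\<lambda>j. \<integral>\<omega>. clamp c (Y j \<omega>) \<partial>M) \<longlonglongrightarrow> (\<integral>\<omega>. clamp c (Z \<omega>) \<partial>M)"
    proof (rule integral_dominated_convergence[where w = "\<lambda>_. c"])
      show "AE \<omega> in M. (\<lambda>j. clamp c (Y j \<omega>)) \<longlonglongrightarrow> clamp c (Z \<omega>)"
        using lim unfolding clamp_def by eventually_elim (intro tendsto_intros)
    qed (use c(1) in \<open>auto simp: clamp_def\<close>)
    then obtain j0 where j0: "\<And>j. j0 \<le> j \<Longrightarrow> norm ((\<integral>\<omega>. clamp c (Y j \<omega>) \<partial>M) - (\<integral>\<omega>. clamp c (Z \<omega>) \<partial>M)) < r / 4"
      using LIMSEQ_D[OF _ r] by metis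
    have "norm ((\<integral>\<omega>. Y j \<omega> \<partial>M) - (\<integral>\<omega>. Z \<omega> \<partial>M)) < r" if "j0 \<le> j" for j
      using trunc[OF Y_int tail c(1), of j] trunc[OF Z_int tailZ c(1)] j0[OF that] r
      unfolding real_norm_def by linarith
    then show "\<exists>j0. \<forall>j\<ge>j0. norm ((\<integral>\<omega>. Y j \<omega> \<partial>M) - (\<integral>\<omega>. Z \<omega> \<partial>M)) < r" by blast
  qed
qed

end

section \<open>Bounded stopping times\<close>

text \<open>Lets a union over all times be replaced by a countable union over rational times, both
  for entrance times and for the oscillation event.\<close>

lemma right_continuous_rational_witness:
  fixes f :: "real \<Rightarrow> 'b::topological_space"
  assumes "(f \<longlongrightarrow> f s) (at_right s)" "open U" "f s \<in> U" "s < u"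
  shows "\<exists>q\<in>\<rat>. s < q \<and> q < u \<and> f q \<in> U"
proof -
  have "\<forall>\<^sub>F r in at_right s. f r \<in> U" using assms(1-3) by (rule topological_tendstoD)
  moreover have "\<forall>\<^sub>F r in at_right s. r < u" using assms(4) by (auto simp: eventually_at_right)
  ultimately have "\<forall>\<^sub>F r in at_right s. f r \<in> U \<and> r < u" by (rule eventually_conj)
  then obtain b where b: "s < b" "\<And>r. \<lbrakk>s < r; r < b\<rbrakk> \<Longrightarrow> f r \<in> U \<and> r < u"
    unfolding eventually_at_right_field by blast
  obtain q where "q \<in> \<rat>" "s < q" "q < b" using Rats_dense_in_real[OF b(1)] by auto
  with b(2)[of q] show ?thesis by (intro bexI[of _ q]) auto
qed

section \<open>Consequences of the usual conditions, and stopping times built from them\<close>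

locale usual_space =
  fixes M :: "'a measure" and F :: "real \<Rightarrow> 'a measure"
  assumes usual: "usual_filtered_space M F"
begin

sublocale prob_space M using usual by (simp add: usual_filtered_space_def)

sublocale complete_measure M using usual by (simp add: usual_filtered_space_def)

lemma subalgebra_F: "0 \<le> t \<Longrightarrow> subalgebra M (F t)"
  using usual by (simp add: usual_filtered_space_def)

lemma space_F: "0 \<le> t \<Longrightarrow> space (F t) = space M"
  using subalgebra_F by (simp add: subalgebra_def)

lemma sets_F_subset: "0 \<le> t \<Longrightarrow> sets (F t) \<subseteq> sets M"
  using subalgebra_F by (simp add: subalgebra_def)

lemma sets_F_mono: "\<lbrakk>0 \<le> s; s \<le> t\<rbrakk> \<Longrightarrow> sets (F s) \<subseteq> sets (F t)"
proof -
  assume "0 \<le> s" "s \<le> t"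
  moreover have "filtration (space M) (\<lambda>t. F (max 0 t))"
    using usual by (simp add: usual_filtered_space_def)
  ultimately show ?thesis using filtration.sets_F_mono[of "space M" "\<lambda>t. F (max 0 t)" s t] by simp
qed

lemma sets_F_right: "\<lbrakk>0 \<le> t; \<And>s. t < s \<Longrightarrow> B \<in> sets (F s)\<rbrakk> \<Longrightarrow> B \<in> sets (F t)"
proof -
  assume t: "0 \<le> t" and B: "\<And>s. t < s \<Longrightarrow> B \<in> sets (F s)"
  have "sets (F t) = (\<Inter>s\<in>{t<..}. sets (F s))"
    using usual t unfolding usual_filtered_space_def by blast
  with B show ?thesis by auto
qed

lemma sets_F_null: "\<lbrakk>0 \<le> t; B \<in> null_sets M\<rbrakk> \<Longrightarrow> B \<in> sets (F t)"
  using usual sets_F_mono[of 0 t] unfolding usual_filtered_space_def by blast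

text \<open>Since \<open>F 0\<close> contains all null sets and \<open>M\<close> is complete, every
  subset of a null set lies in each \<open>F t\<close>. Path arguments valid only almost surely thus
  still decide membership in \<open>F t\<close>.\<close>

lemma sets_F_AE_eq:
  assumes t: "0 \<le> t" and C: "C \<in> sets (F t)" and B: "B \<subseteq> space M"
    and ae: "AE \<omega> in M. \<omega> \<in> B \<longleftrightarrow> \<omega> \<in> C"
  shows "B \<in> sets (F t)"
proof -
  have CM: "C \<subseteq> space M" using C sets.sets_into_space space_F[OF t] by blast
  obtain Z where Z: "Z \<in> null_sets M" "{\<omega>\<in>space M. \<not> (\<omega> \<in> B \<longleftrightarrow> \<omega> \<in> C)} \<subseteq> Z"
    using ae unfolding eventually_ae_filter by auto
  have sub: "D \<in> sets (F t)" if "D \<subseteq> Z" for D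
    using complete2[OF that Z(1)] by (rule sets_F_null[OF t])
  have "B = (C - Z) \<union> (B \<inter> Z)" using Z(2) B CM by auto
  moreover have "(C - Z) \<union> (B \<inter> Z) \<in> sets (F t)"
    using C sub[of Z] sub[of "B \<inter> Z"] by auto
  ultimately show ?thesis by simp
qed

text \<open>The bounds hold on the whole type and not just on \<open>space M\<close>, so that
  finitely many values can be expressed by \<open>finite (range S)\<close>.\<close>

definition bounded_stopping :: "('a \<Rightarrow> real) \<Rightarrow> real \<Rightarrow> bool" where
  "bounded_stopping S t \<longleftrightarrow> (\<forall>\<omega>. 0 \<le> S \<omega> \<and> S \<omega> \<le> t) \<and> (\<forall>s\<ge>0. {\<omega>\<in>space M. S \<omega> \<le> s} \<in> sets (F s))"

lemma bounded_stoppingD: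
  assumes "bounded_stopping S t"
  shows "0 \<le> S \<omega>" "S \<omega> \<le> t" "0 \<le> s \<Longrightarrow> {\<omega>\<in>space M. S \<omega> \<le> s} \<in> sets (F s)"
  using assms by (auto simp: bounded_stopping_def)

lemma bounded_stopping_const: "\<lbrakk>0 \<le> u; u \<le> t\<rbrakk> \<Longrightarrow> bounded_stopping (\<lambda>_. u) t"
proof -
  assume "0 \<le> u" "u \<le> t"
  moreover have "{\<omega>\<in>space M. u \<le> s} \<in> sets (F s)" if "0 \<le> s" for s
    using sets.top[of "F s"] space_F[OF that] by (cases "u \<le> s") auto
  ultimately show ?thesis unfolding bounded_stopping_def by blast
qed

lemma bounded_stopping_measurable:
  assumes "bounded_stopping S t" shows "S \<in> borel_measurable M"
proof (rule borel_measurableI_le)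
  fix s
  show "{\<omega>\<in>space M. S \<omega> \<le> s} \<in> sets M"
  proof (cases "0 \<le> s")
    case True then show ?thesis using bounded_stoppingD(3)[OF assms True] sets_F_subset by auto
  next
    case False
    then have "{\<omega>\<in>space M. S \<omega> \<le> s} = {}"
      using bounded_stoppingD(1)[OF assms] by (auto simp: not_le intro: less_le_trans)
    then show ?thesis by (simp only: sets.empty_sets)
  qed
qed

lemma bounded_stopping_less:
  assumes S: "bounded_stopping S t" and s: "0 \<le> s"
  shows "{\<omega>\<in>space M. S \<omega> < s} \<in> sets (F s)"
proof (cases "s = 0")
  case True
  then have "{\<omega>\<in>space M. S \<omega> < s} = {}" using bounded_stoppingD(1)[OF S] by (auto simp: not_less)
  then show ?thesis by (simp only: sets.empty_sets)
next
  case False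
  \<comment> \<open>The maximum with 0 keeps the indices in the time set; as s is positive here,
    they still lie strictly below s.\<close>
  have "{\<omega>\<in>space M. S \<omega> < s} = (\<Union>n. {\<omega>\<in>space M. S \<omega> \<le> max 0 (s - 1 / Suc n)})"
  proof (intro set_eqI iffI)
    fix \<omega> assume "\<omega> \<in> {\<omega>\<in>space M. S \<omega> < s}"
    then obtain n where "1 / real (Suc n) < s - S \<omega>" "\<omega> \<in> space M"
      using reals_Archimedean[of "s - S \<omega>"] by (auto simp: inverse_eq_divide)
    then show "\<omega> \<in> (\<Union>n. {\<omega>\<in>space M. S \<omega> \<le> max 0 (s - 1 / Suc n)})"
      by (intro UN_I[of n]) auto
  next
    fix \<omega> assume "\<omega> \<in> (\<Union>n. {\<omega>\<in>space M. S \<omega> \<le> max 0 (s - 1 / Suc n)})"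
    then obtain n where "S \<omega> \<le> max 0 (s - 1 / real (Suc n))" "\<omega> \<in> space M" by blast
    moreover have "max 0 (s - 1 / real (Suc n)) < s" using False s by simp
    ultimately show "\<omega> \<in> {\<omega>\<in>space M. S \<omega> < s}" using le_less_trans by blast
  qed
  moreover have "{\<omega>\<in>space M. S \<omega> \<le> max 0 (s - 1 / real (Suc n))} \<in> sets (F s)" for n
  proof -
    have "{\<omega>\<in>space M. S \<omega> \<le> max 0 (s - 1 / real (Suc n))} \<in> sets (F (max 0 (s - 1 / real (Suc n))))"
      by (rule bounded_stoppingD(3)[OF S]) simp
    then show ?thesis using sets_F_mono[of "max 0 (s - 1 / real (Suc n))" s] s by auto
  qed
  ultimately show ?thesis by auto
qed

text \<open>
  The next point of the mesh \<open>1 / (k + 1)\<close> strictly after \<open>x\<close>: strictness makes the discretisation of a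
  stopping time converge from the right, and lets \<open>grid t k x \<le> s\<close> be decided by \<open>x < r\<close> for some \<open>r \<le> s\<close>.
\<close>

definition grid :: "real \<Rightarrow> nat \<Rightarrow> real \<Rightarrow> real" where
  "grid t k x = min t ((real_of_int \<lfloor>real (Suc k) * x\<rfloor> + 1) / real (Suc k))"

lemma grid_bounds: "min t (x) \<le> grid t k x" "x < t \<Longrightarrow> x < grid t k x"
  "grid t k x \<le> x + 1 / real (Suc k)" "grid t k x \<le> t"
proof -
  let ?r = "(real_of_int \<lfloor>real (Suc k) * x\<rfloor> + 1) / real (Suc k)"
  have "real (Suc k) * x < real_of_int \<lfloor>real (Suc k) * x\<rfloor> + 1" by linarith
  then have 1: "x < ?r" by (simp add: field_simps)
  have "real_of_int \<lfloor>real (Suc k) * x\<rfloor> + 1 \<le> real (Suc k) * x + 1" by linarith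
  then have "?r \<le> (real (Suc k) * x + 1) / real (Suc k)" by (rule divide_right_mono) simp
  also have "\<dots> = x + 1 / real (Suc k)" by (simp add: add_divide_distrib del: of_nat_Suc)
  finally have 2: "?r \<le> x + 1 / real (Suc k)" .
  show "min t (x) \<le> grid t k x" "x < t \<Longrightarrow> x < grid t k x"
    "grid t k x \<le> x + 1 / real (Suc k)" "grid t k x \<le> t"
    using 1 2 unfolding grid_def by auto
qed

lemma grid_finite:
  assumes S: "bounded_stopping S t"
  shows "finite (range (\<lambda>\<omega>. grid t k (S \<omega>)))"
proof (rule finite_subset)
  show "range (\<lambda>\<omega>. grid t k (S \<omega>)) \<subseteq> (\<lambda>i::int. min t ((real_of_int i + 1) / real (Suc k))) ` {0..\<lfloor>real (Suc k) * t\<rfloor>}"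
  proof (rule image_subsetI)
    fix \<omega>
    have "0 \<le> real (Suc k) * S \<omega>" "real (Suc k) * S \<omega> \<le> real (Suc k) * t"
      using bounded_stoppingD(1,2)[OF S, of \<omega>] by (auto intro!: mult_left_mono)
    then have "\<lfloor>real (Suc k) * S \<omega>\<rfloor> \<in> {0..\<lfloor>real (Suc k) * t\<rfloor>}" by (auto intro: floor_mono)
    then show "grid t k (S \<omega>) \<in> (\<lambda>i::int. min t ((real_of_int i + 1) / real (Suc k))) ` {0..\<lfloor>real (Suc k) * t\<rfloor>}"
      unfolding grid_def by blast
  qed
qed simp

lemma grid_stopping:
  assumes S: "bounded_stopping S t"
  shows "bounded_stopping (\<lambda>\<omega>. grid t k (S \<omega>)) t"
  unfolding bounded_stopping_def
proof (intro conjI allI impI)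
  fix \<omega>
  show "0 \<le> grid t k (S \<omega>)"
    using bounded_stoppingD(1,2)[OF S, of \<omega>] grid_bounds(1)[of t "S \<omega>" k] by auto
  show "grid t k (S \<omega>) \<le> t" by (rule grid_bounds)
next
  fix s :: real assume s: "0 \<le> s"
  \<comment> \<open>\<open>r\<close> is the last mesh point not after \<open>s\<close>. For s < t
    the discretised time is at most \<open>s\<close> exactly when the original time is strictly
    below \<open>r\<close>, an event of \<open>F r\<close> and hence of \<open>F s\<close>.\<close>
  define r where "r = real_of_int \<lfloor>real (Suc k) * s\<rfloor> / real (Suc k)"
  have r: "0 \<le> r" "r \<le> s"
  proof -
    have "0 \<le> \<lfloor>real (Suc k) * s\<rfloor>" using s by simp
    then show "0 \<le> r" unfolding r_def by simp
    have "real_of_int \<lfloor>real (Suc k) * s\<rfloor> \<le> real (Suc k) * s" by linarith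
    then show "r \<le> s" unfolding r_def by (simp add: divide_le_eq mult.commute)
  qed
  show "{\<omega>\<in>space M. grid t k (S \<omega>) \<le> s} \<in> sets (F s)"
  proof (cases "t \<le> s")
    case True
    then have "{\<omega>\<in>space M. grid t k (S \<omega>) \<le> s} = space (F s)"
      using grid_bounds(4)[of t k] space_F[OF s] by (auto intro: order_trans)
    then show ?thesis by simp
  next
    case False
    have "grid t k (S \<omega>) \<le> s \<longleftrightarrow> S \<omega> < r" for \<omega>
    proof -
      have "grid t k (S \<omega>) \<le> s \<longleftrightarrow> real_of_int \<lfloor>real (Suc k) * S \<omega>\<rfloor> + 1 \<le> real (Suc k) * s"
        using False unfolding grid_def by (auto simp: min_le_iff_disj divide_le_eq mult.commute)
      also have "\<dots> \<longleftrightarrow> \<lfloor>real (Suc k) * S \<omega>\<rfloor> + 1 \<le> \<lfloor>real (Suc k) * s\<rfloor>"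
        by (simp add: le_floor_iff)
      also have "\<dots> \<longleftrightarrow> real (Suc k) * S \<omega> < real_of_int \<lfloor>real (Suc k) * s\<rfloor>"
        by (simp add: floor_less_iff[symmetric] del: of_nat_Suc) linarith
      also have "\<dots> \<longleftrightarrow> S \<omega> < r" unfolding r_def by (simp add: less_divide_eq mult.commute)
      finally show ?thesis .
    qed
    then show ?thesis using bounded_stopping_less[OF S r(1)] sets_F_mono[OF r] by auto
  qed
qed

lemma grid_tendsto: "x \<le> t \<Longrightarrow> (\<lambda>k. grid t k x) \<longlonglongrightarrow> x"
proof (rule tendsto_sandwich[of "\<lambda>_. x" _ _ "\<lambda>k. x + 1 / real (Suc k)"])
  assume "x \<le> t"
  then show "\<forall>\<^sub>F k in sequentially. x \<le> grid t k x"
    using grid_bounds(1)[of t x] by (auto simp: min_absorb2)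
  show "\<forall>\<^sub>F k in sequentially. grid t k x \<le> x + 1 / real (Suc k)"
    using grid_bounds(3) by auto
  show "(\<lambda>k. x + 1 / real (Suc k)) \<longlonglongrightarrow> x"
    using tendsto_add[OF tendsto_const LIMSEQ_inverse_real_of_nat, of "x"]
    by (simp add: inverse_eq_divide)
qed simp

text \<open>At the cap x = t the grid does not move; below it all grid points are strictly to the
  right of x, so a right limit suffices.\<close>

lemma grid_right_continuous:
  assumes rc: "(f \<longlongrightarrow> f (x)) (at_right (x))" and le: "x \<le> t"
  shows "(\<lambda>k. f (grid t k x)) \<longlonglongrightarrow> f (x)"
proof (cases "x = t")
  case True
  then have "grid t k x = x" for k using grid_bounds(1)[of t x k] grid_bounds(4)[of t k x] by simp
  then show ?thesis by simp
next
  case False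
  then have "\<forall>k. x < grid t k x" using grid_bounds(2)[of x t] le by auto
  then have "filterlim (\<lambda>k. grid t k x) (at_right (x)) sequentially"
    using grid_tendsto[OF le] by (auto simp: filterlim_at less_imp_neq[symmetric])
  then show ?thesis by (rule filterlim_compose[OF rc])
qed

text \<open>Decompose over the finitely many values r of \<open>S\<close>. The event S = r lies in
  \<open>F r\<close>, so on it \<open>Z r\<close> may be exchanged for \<open>Z t\<close> under the
  integral, and the pieces reassemble to the integral of \<open>Z t\<close>.\<close>

lemma martingale_optional_finite:
  assumes Z: "martingale M F Z" and S: "bounded_stopping S t" and fin: "finite (range S)"
  shows "integrable M (\<lambda>\<omega>. Z (S \<omega>) \<omega>)" "(\<integral>\<omega>. Z (S \<omega>) \<omega> \<partial>M) = (\<integral>\<omega>. Z 0 \<omega> \<partial>M)"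
proof -
  have t: "0 \<le> t" using bounded_stoppingD(1,2)[OF S] order_trans by blast
  have Z_int: "integrable M (Z r)" if "0 \<le> r" for r using Z that by (auto simp: martingale_def)
  have range: "0 \<le> r" "r \<le> t" if "r \<in> range S" for r
    using that bounded_stoppingD(1,2)[OF S] by auto
  have ev: "{\<omega>\<in>space M. S \<omega> = r} \<in> sets (F r)" if "r \<in> range S" for r
  proof -
    have "{\<omega>\<in>space M. S \<omega> = r} = {\<omega>\<in>space M. S \<omega> \<le> r} - {\<omega>\<in>space M. S \<omega> < r}" by auto
    then show ?thesis
      using bounded_stoppingD(3)[OF S range(1)] bounded_stopping_less[OF S range(1)] that by auto
  qed
  have evM: "{\<omega>\<in>space M. S \<omega> = r} \<in> sets M" if "r \<in> range S" for r
    using ev[OF that] sets_F_subset[OF range(1)[OF that]] by auto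
  have step: "(\<integral>\<omega>\<in>B. Z v \<omega> \<partial>M) = (\<integral>\<omega>\<in>B. Z u \<omega> \<partial>M)"
    if "0 \<le> u" "u \<le> v" and B: "B \<in> sets (F u)" for u v B
  proof -
    interpret sigma_finite_subalgebra M "F u"
      by (rule finite_measure_subalgebra_is_sigma_finite[unfolded finite_measure_subalgebra_def finite_measure_subalgebra_axioms_def])
        (use subalgebra_F[OF that(1)] finite_measure_axioms in auto)
    have "(\<integral>\<omega>\<in>B. Z v \<omega> \<partial>M) = (\<integral>\<omega>\<in>B. real_cond_exp M (F u) (Z v) \<omega> \<partial>M)"
      by (rule real_cond_exp_intA[OF Z_int B]) (use that in auto)
    also have "\<dots> = (\<integral>\<omega>\<in>B. Z u \<omega> \<partial>M)"
    proof (rule set_lebesgue_integral_cong_AE)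
      show "B \<in> sets M" using B sets_F_subset[OF that(1)] by auto
      show "AE \<omega> in M. \<omega> \<in> B \<longrightarrow> real_cond_exp M (F u) (Z v) \<omega> = Z u \<omega>"
      proof -
        have "AE \<omega> in M. real_cond_exp M (F u) (Z v) \<omega> = Z u \<omega>"
          using Z that unfolding martingale_def by blast
        then show ?thesis by eventually_elim simp
      qed
    qed (use Z_int that borel_measurable_integrable in \<open>auto simp: borel_measurable_cond_exp2\<close>)
    finally show ?thesis .
  qed
  have Z_S: "Z (S \<omega>) \<omega> = (\<Sum>r\<in>range S. indicator {\<omega>\<in>space M. S \<omega> = r} \<omega> * Z r \<omega>)"
    if "\<omega> \<in> space M" for \<omega>
  proof -
    have "(\<Sum>r\<in>range S. indicator {\<omega>\<in>space M. S \<omega> = r} \<omega> * Z r \<omega>) =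
      (\<Sum>r\<in>range S. if r = S \<omega> then Z r \<omega> else 0)"
      using that by (intro sum.cong) (auto split: split_indicator)
    then show ?thesis using fin by simp
  qed
  have ind_int: "integrable M (\<lambda>\<omega>. indicator {\<omega>\<in>space M. S \<omega> = r} \<omega> * Z u \<omega>)"
    if "r \<in> range S" "0 \<le> u" for r u
    using integrable_real_mult_indicator[OF evM[OF that(1)] Z_int[OF that(2)]] by (simp add: mult.commute)
  have "integrable M (\<lambda>\<omega>. \<Sum>r\<in>range S. indicator {\<omega>\<in>space M. S \<omega> = r} \<omega> * Z r \<omega>)"
    using ind_int range by (intro Bochner_Integration.integrable_sum) auto
  then show "integrable M (\<lambda>\<omega>. Z (S \<omega>) \<omega>)"
    by (rule Bochner_Integration.integrable_cong[THEN iffD1, rotated -1]) (use Z_S in auto)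
  have "(\<integral>\<omega>. Z (S \<omega>) \<omega> \<partial>M) = (\<integral>\<omega>. (\<Sum>r\<in>range S. indicator {\<omega>\<in>space M. S \<omega> = r} \<omega> * Z r \<omega>) \<partial>M)"
    using Z_S by (intro Bochner_Integration.integral_cong) auto
  also have "\<dots> = (\<Sum>r\<in>range S. \<integral>\<omega>. indicator {\<omega>\<in>space M. S \<omega> = r} \<omega> * Z r \<omega> \<partial>M)"
    using ind_int range by (intro Bochner_Integration.integral_sum) auto
  also have "\<dots> = (\<Sum>r\<in>range S. \<integral>\<omega>. indicator {\<omega>\<in>space M. S \<omega> = r} \<omega> * Z t \<omega> \<partial>M)"
    using step[OF range ev] by (intro sum.cong) (auto simp: set_lebesgue_integral_def)
  also have "\<dots> = (\<integral>\<omega>. (\<Sum>r\<in>range S. indicator {\<omega>\<in>space M. S \<omega> = r} \<omega> * Z t \<omega>) \<partial>M)"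
    using ind_int t by (intro Bochner_Integration.integral_sum[symmetric]) auto
  also have "\<dots> = (\<integral>\<omega>. Z t \<omega> \<partial>M)"
  proof (rule Bochner_Integration.integral_cong)
    fix \<omega> assume "\<omega> \<in> space M"
    then have "(\<Sum>r\<in>range S. indicator {\<omega>\<in>space M. S \<omega> = r} \<omega> * Z t \<omega>) =
      (\<Sum>r\<in>range S. if r = S \<omega> then Z t \<omega> else 0)"
      by (intro sum.cong) (auto split: split_indicator)
    then show "(\<Sum>r\<in>range S. indicator {\<omega>\<in>space M. S \<omega> = r} \<omega> * Z t \<omega>) = Z t \<omega>"
      using fin by simp
  qed simp
  also have "\<dots> = (\<integral>\<omega>. Z 0 \<omega> \<partial>M)"
  proof -
    have "space M \<in> sets (F 0)" using sets.top[of "F 0"] space_F[of 0] by simp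
    from step[OF order_refl t this] show ?thesis using t Z_int
      by (simp add: set_integral_space)
  qed
  finally show "(\<integral>\<omega>. Z (S \<omega>) \<omega> \<partial>M) = (\<integral>\<omega>. Z 0 \<omega> \<partial>M)" .
qed

text \<open>Inserting \<open>t\<close> caps the time and keeps the infimum away from the empty set.
  The event \<open>C\<close> serves the oscillation argument: outside it two entrance times into
  different sets are both \<open>t\<close>, so their stopped values cancel.\<close>

definition hit :: "(real \<Rightarrow> 'a \<Rightarrow> real) \<Rightarrow> real set \<Rightarrow> 'a set \<Rightarrow> real \<Rightarrow> real \<Rightarrow> 'a \<Rightarrow> real" where
  "hit Z U C m t \<omega> = Inf (insert t {s. m \<le> s \<and> s \<le> t \<and> \<omega> \<in> C \<and> Z s \<omega> \<in> U})"

lemma hit_bounds: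
  assumes "m \<le> t" shows "m \<le> hit Z U C m t \<omega>" "hit Z U C m t \<omega> \<le> t"
  using assms unfolding hit_def
  by (auto intro!: cInf_greatest cInf_lower bdd_belowI[where m = m])

text \<open>The strict inequality avoids the question whether the infimum is attained, and u \<le> t
  keeps the inserted point \<open>t\<close> from counting.\<close>

lemma hit_less_iff:
  assumes "m \<le> t" "u \<le> t"
  shows "hit Z U C m t \<omega> < u \<longleftrightarrow> \<omega> \<in> C \<and> (\<exists>s. m \<le> s \<and> s < u \<and> Z s \<omega> \<in> U)"
  unfolding hit_def using assms
  by (subst cInf_less_iff) (auto intro!: bdd_belowI[where m = m])

text \<open>For open \<open>U\<close> and right continuous paths an entrance before u can be
  witnessed at a rational time before u, so the event that the time is below u lies in
  \<open>F u\<close> up to a null set. Right continuity of the filtration passes from strict to weak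
  inequality.\<close>

lemma hit_stopping:
  assumes Z: "adapted F Z" and rc: "AE \<omega> in M. \<forall>s\<ge>0. ((\<lambda>s. Z s \<omega>) \<longlongrightarrow> Z s \<omega>) (at_right s)"
    and U: "open U" and m: "0 \<le> m" "m \<le> t" and C: "C \<in> sets (F m)"
  shows "bounded_stopping (hit Z U C m t) t"
  unfolding bounded_stopping_def
proof (intro conjI allI impI)
  fix \<omega> show "0 \<le> hit Z U C m t \<omega>" "hit Z U C m t \<omega> \<le> t"
    using hit_bounds[OF m(2)] m(1) by (auto intro: order_trans)
next
  have less: "{\<omega>\<in>space M. hit Z U C m t \<omega> < u} \<in> sets (F u)" if u: "0 \<le> u" "u \<le> t" for u
  proof (cases "m \<le> u")
    case True
    define D where "D = (\<Union>q\<in>\<rat> \<inter> {m..<u}. {\<omega>\<in>space M. Z q \<omega> \<in> U})"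
    have "D \<in> sets (F u)"
      unfolding D_def
    proof (rule sets.countable_UN'[OF countable_Int1[OF countable_rat] image_subsetI])
      fix q assume q: "q \<in> \<rat> \<inter> {m..<u}"
      then have q0: "0 \<le> q" using m by auto
      have "Z q \<in> borel_measurable (F q)" using Z q0 by (auto simp: adapted_def)
      from measurable_sets[OF this, of U] U have "{\<omega>\<in>space M. Z q \<omega> \<in> U} \<in> sets (F q)"
        by (simp add: space_F[OF q0] vimage_def Int_def conj_commute)
      then show "{\<omega>\<in>space M. Z q \<omega> \<in> U} \<in> sets (F u)" using sets_F_mono[OF q0, of u] q by auto
    qed
    moreover have Cu: "C \<in> sets (F u)" using C sets_F_mono[OF m(1) True] by auto
    ultimately have CD: "C \<inter> D \<in> sets (F u)" by auto
    show ?thesis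
    proof (rule sets_F_AE_eq[OF u(1) CD])
      show "AE \<omega> in M. (\<omega> \<in> {\<omega>\<in>space M. hit Z U C m t \<omega> < u}) = (\<omega> \<in> C \<inter> D)"
        using rc AE_space
      proof eventually_elim
        case (elim \<omega>)
        have "\<exists>q\<in>\<rat> \<inter> {m..<u}. Z q \<omega> \<in> U" if s: "m \<le> s" "s < u" "Z s \<omega> \<in> U" for s
        proof -
          have "((\<lambda>s. Z s \<omega>) \<longlongrightarrow> Z s \<omega>) (at_right s)" using elim(1) s m by auto
          from right_continuous_rational_witness[OF this U s(3,2)] s(1) show ?thesis by force
        qed
        with elim(2) show ?case unfolding D_def
          by (auto simp: hit_less_iff[OF m(2) u(2)])
      qed
    qed auto
  next
    case False
    then have "{\<omega>\<in>space M. hit Z U C m t \<omega> < u} = {}"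
      using hit_bounds(1)[OF m(2), of Z U C] by (auto simp: not_less not_le intro: order_trans less_imp_le)
    then show ?thesis by (simp only: sets.empty_sets)
  qed
  fix s :: real assume s: "0 \<le> s"
  show "{\<omega>\<in>space M. hit Z U C m t \<omega> \<le> s} \<in> sets (F s)"
  proof (cases "t \<le> s")
    case True
    then have "{\<omega>\<in>space M. hit Z U C m t \<omega> \<le> s} = space (F s)"
      using order_trans[OF hit_bounds(2)[OF m(2)] True] space_F[OF s] by auto
    then show ?thesis by (simp only: sets.top)
  next
    case False
    show ?thesis
    proof (rule sets_F_right[OF s])
      fix r assume "s < r"
      \<comment> \<open>The points lie in (s, min r t] and tend to s: at most \<open>t\<close> for
        \<open>less\<close> to apply, at most \<open>r\<close> to stay inside
        \<open>F r\<close>.\<close>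
      define v where "v n = s + (min r t - s) / real (Suc n)" for n
      have v: "s < v n" "v n \<le> min r t" for n
      proof -
        have "0 < min r t - s" using False \<open>s < r\<close> by simp
        then show "s < v n" "v n \<le> min r t"
          using divide_left_mono[of 1 "real (Suc n)" "min r t - s"] unfolding v_def by auto
      qed
      have "v \<longlonglongrightarrow> s"
        using tendsto_add[OF tendsto_const tendsto_mult[OF tendsto_const LIMSEQ_inverse_real_of_nat], of s "min r t - s"]
        unfolding v_def by (simp add: divide_inverse)
      have "{\<omega>\<in>space M. hit Z U C m t \<omega> \<le> s} = (\<Inter>n. {\<omega>\<in>space M. hit Z U C m t \<omega> < v n})"
      proof (intro set_eqI iffI)
        fix \<omega> assume "\<omega> \<in> (\<Inter>n. {\<omega>\<in>space M. hit Z U C m t \<omega> < v n})"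
        then have "\<omega> \<in> space M" "\<And>n. hit Z U C m t \<omega> \<le> v n" by (auto simp: less_imp_le)
        with LIMSEQ_le_const[OF \<open>v \<longlonglongrightarrow> s\<close>] show "\<omega> \<in> {\<omega>\<in>space M. hit Z U C m t \<omega> \<le> s}" by auto
      qed (use v(1) in \<open>auto intro: le_less_trans\<close>)
      moreover have "{\<omega>\<in>space M. hit Z U C m t \<omega> < v n} \<in> sets (F r)" for n
        using less[of "v n"] v[of n] s sets_F_mono[of "v n" r] by auto
      ultimately show "{\<omega>\<in>space M. hit Z U C m t \<omega> \<le> s} \<in> sets (F r)" by auto
    qed
  qed
qed

text \<open>If the path were in the open complement of the closure at this time, right continuity
  would keep it there for a while, although entrances occur arbitrarily soon. Only the closure is
  reached in general, since the infimum need not be attained.\<close>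

lemma hit_closure:
  assumes m: "0 \<le> m" "m \<le> t" and less: "hit Z U C m t \<omega> < t"
    and rc: "\<And>s. 0 \<le> s \<Longrightarrow> ((\<lambda>s. Z s \<omega>) \<longlongrightarrow> Z s \<omega>) (at_right s)"
  shows "Z (hit Z U C m t \<omega>) \<omega> \<in> closure U"
proof (rule ccontr)
  define h where "h = hit Z U C m t \<omega>"
  assume "Z (hit Z U C m t \<omega>) \<omega> \<notin> closure U"
  then have h: "Z h \<omega> \<in> - closure U" by (simp add: h_def)
  have "m \<le> h" unfolding h_def by (rule hit_bounds[OF m(2)])
  then have "((\<lambda>s. Z s \<omega>) \<longlongrightarrow> Z h \<omega>) (at_right h)" using rc m(1) by auto
  then have "\<forall>\<^sub>F r in at_right h. Z r \<omega> \<in> - closure U"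
    using h by (intro topological_tendstoD) auto
  then obtain b where b: "h < b" "\<And>r. \<lbrakk>h < r; r < b\<rbrakk> \<Longrightarrow> Z r \<omega> \<notin> closure U"
    unfolding eventually_at_right_field by auto
  have "hit Z U C m t \<omega> < min b t" using b(1) less by (simp add: h_def)
  then obtain s where s: "\<omega> \<in> C" "m \<le> s" "s < min b t" "Z s \<omega> \<in> U"
    using hit_less_iff[OF m(2), of "min b t"] by auto
  have "h \<le> s"
    unfolding h_def hit_def using s by (intro cInf_lower bdd_belowI[where m = m]) (auto simp: m(2))
  then show False using b(2)[of s] s h closure_subset[of U] by (cases "s = h") auto
qed

end

section \<open>Optional stopping\<close>

locale sigma_D_process = usual_space M F
  for M :: "'a measure" and F :: "real \<Rightarrow> 'a measure" +
  fixes X N A :: "real \<Rightarrow> 'a \<Rightarrow> real"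
  assumes sigma_D: "class_Sigma_D M F X N A"
begin

lemma sigma: "class_Sigma M F X N A"
  using sigma_D unfolding class_Sigma_D_def by blast

lemma adapted_X: "adapted F X" and adapted_A: "adapted F A"
  using sigma unfolding class_Sigma_def local_submartingale_def by blast+

lemma X_measurable: "0 \<le> t \<Longrightarrow> X t \<in> borel_measurable M"
  and A_measurable: "0 \<le> t \<Longrightarrow> A t \<in> borel_measurable M"
  using adapted_X adapted_A measurable_from_subalg[OF subalgebra_F]
  unfolding adapted_def by blast+

lemma X_right_continuous: "AE \<omega> in M. \<forall>s\<ge>0. ((\<lambda>s. X s \<omega>) \<longlongrightarrow> X s \<omega>) (at_right s)"
proof -
  have "AE \<omega> in M. cadlag (\<lambda>t. X t \<omega>)"
    using sigma unfolding class_Sigma_def local_submartingale_def by blast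
  then show ?thesis by eventually_elim (simp add: cadlag_def)
qed

lemma X_nonneg: "AE \<omega> in M. \<forall>t\<ge>0. 0 \<le> X t \<omega>"
  and X_eq: "AE \<omega> in M. \<forall>t\<ge>0. X t \<omega> = N t \<omega> + A t \<omega>"
  and N_0: "AE \<omega> in M. N 0 \<omega> = 0"
  and A_path: "AE \<omega> in M. continuous_on {0..} (\<lambda>t. A t \<omega>) \<and> mono_on {0..} (\<lambda>t. A t \<omega>) \<and> A 0 \<omega> = 0"
  and A_carried: "AE \<omega> in M. AE t in path_measure A \<omega>. 0 \<le> t \<and> X t \<omega> = 0"
  using sigma unfolding class_Sigma_def by blast+

lemma A_mono: "AE \<omega> in M. \<forall>s t. 0 \<le> s \<longrightarrow> s \<le> t \<longrightarrow> A s \<omega> \<le> A t \<omega>"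
  using A_path by eventually_elim (auto simp: mono_on_def)

lemma A_nonneg: "AE \<omega> in M. \<forall>t\<ge>0. 0 \<le> A t \<omega>"
  using A_path A_mono
proof eventually_elim
  case (elim \<omega>)
  then have "A 0 \<omega> = 0" "\<And>t. 0 \<le> t \<Longrightarrow> A 0 \<omega> \<le> A t \<omega>" by blast+
  then show ?case by simp
qed

lemma A_right_continuous: "AE \<omega> in M. \<forall>s\<ge>0. ((\<lambda>s. A s \<omega>) \<longlongrightarrow> A s \<omega>) (at_right s)"
  using A_path
proof eventually_elim
  case (elim \<omega>)
  show ?case
  proof (intro allI impI)
    fix s :: real assume "0 \<le> s"
    with elim have "((\<lambda>s. A s \<omega>) \<longlongrightarrow> A s \<omega>) (at s within {0..})"
      by (simp add: continuous_on_def)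
    then show "((\<lambda>s. A s \<omega>) \<longlongrightarrow> A s \<omega>) (at_right s)"
      by (rule tendsto_within_subset) (use \<open>0 \<le> s\<close> in auto)
  qed
qed

definition stopped_values :: "('a \<Rightarrow> real) set" where
  "stopped_values = {(\<lambda>\<omega>. X (enn2real (T \<omega>)) \<omega>) | T.
     ext_stopping_time F T \<and> (\<forall>\<omega>\<in>space M. T \<omega> < \<infinity>)}"

lemma UI: "uniformly_integrable M stopped_values"
  using sigma_D unfolding class_Sigma_D_def class_D_def stopped_values_def by blast

lemma stopped_value:
  assumes S: "bounded_stopping S t"
  shows "(\<lambda>\<omega>. X (S \<omega>) \<omega>) \<in> stopped_values"
proof -
  have "ext_stopping_time F (\<lambda>\<omega>. ennreal (S \<omega>))"
    unfolding ext_stopping_time_def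
  proof (intro allI impI)
    fix s :: real assume s: "0 \<le> s"
    have "{\<omega> \<in> space (F s). ennreal (S \<omega>) \<le> ennreal s} = {\<omega> \<in> space M. S \<omega> \<le> s}"
      using space_F[OF s] s by (auto simp: ennreal_le_iff)
    then show "Measurable.pred (F s) (\<lambda>\<omega>. ennreal (S \<omega>) \<le> ennreal s)"
      unfolding pred_def using bounded_stoppingD(3)[OF S s] by (simp only:)
  qed
  moreover have "(\<lambda>\<omega>. X (S \<omega>) \<omega>) = (\<lambda>\<omega>. X (enn2real (ennreal (S \<omega>))) \<omega>)"
    using bounded_stoppingD(1)[OF S] by simp
  ultimately show ?thesis unfolding stopped_values_def by (intro CollectI exI[of _ "\<lambda>\<omega>. ennreal (S \<omega>)"]) auto
qed

lemma X_stopped_integrable: "bounded_stopping S t \<Longrightarrow> integrable M (\<lambda>\<omega>. X (S \<omega>) \<omega>)"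
  using uniformly_integrable_integrable[OF UI stopped_value] .

text \<open>This is the identity \<open>E[N_S] = 0\<close> expressed through X = N + A.
  Integrability of \<open>A\<close> at \<open>S\<close> is recorded too, as the integral of a
  non-integrable function is 0 by default.\<close>

definition mean_balanced :: "('a \<Rightarrow> real) \<Rightarrow> bool" where
  "mean_balanced S \<longleftrightarrow> integrable M (\<lambda>\<omega>. A (S \<omega>) \<omega>) \<and> (\<integral>\<omega>. X (S \<omega>) \<omega> \<partial>M) = (\<integral>\<omega>. A (S \<omega>) \<omega> \<partial>M)"

text \<open>The times \<open>R n\<close> are the minima of \<open>S\<close> with a localising
  sequence. They may take infinitely many values, so finite optional stopping is applied to the
  stopped process at \<open>S\<close>, which equals \<open>N - N 0\<close> at
  \<open>R n\<close>.\<close>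

lemma localised_balanced:
  assumes S: "bounded_stopping S t" and fin: "finite (range S)"
  obtains R where "\<And>n. bounded_stopping (R n) t" "\<And>n. mean_balanced (R n)"
    "AE \<omega> in M. \<forall>\<^sub>F n in sequentially. R n \<omega> = S \<omega>"
proof -
  have "local_martingale M F N" using sigma unfolding class_Sigma_def by blast
  then obtain T where loc: "localising_sequence M F T"
    and mart: "\<And>n. martingale M F (stopped (\<lambda>t \<omega>. N t \<omega> - N 0 \<omega>) (T n))"
    unfolding local_martingale_def by blast
  have T: "ext_stopping_time F (T n)" for n using loc unfolding localising_sequence_def by blast
  have T_lim: "AE \<omega> in M. (\<lambda>n. T n \<omega>) \<longlonglongrightarrow> \<infinity>"
    using loc unfolding localising_sequence_def by (auto elim: eventually_mono)
  define R where "R n \<omega> = enn2real (min (ennreal (S \<omega>)) (T n \<omega>))" for n \<omega>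
  have R_le: "R n \<omega> \<le> s \<longleftrightarrow> S \<omega> \<le> s \<or> T n \<omega> \<le> ennreal s" if "0 \<le> s" for n \<omega> s
  proof -
    \<comment> \<open>Finiteness matters because \<open>enn2real\<close> would send infinity to
      0.\<close>
    have "min (ennreal (S \<omega>)) (T n \<omega>) < top" by (simp add: min_less_iff_disj)
    then have "ennreal (R n \<omega>) = min (ennreal (S \<omega>)) (T n \<omega>)"
      unfolding R_def by simp
    moreover have "R n \<omega> \<le> s \<longleftrightarrow> ennreal (R n \<omega>) \<le> ennreal s"
      using that by (simp add: ennreal_le_iff)
    ultimately show ?thesis using that by (simp add: min_le_iff_disj ennreal_le_iff)
  qed
  have R: "bounded_stopping (R n) t" for n
    unfolding bounded_stopping_def
  proof (intro conjI allI impI)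
    fix \<omega>
    show "0 \<le> R n \<omega>" unfolding R_def by simp
    show "R n \<omega> \<le> t" using R_le[of t n \<omega>] bounded_stoppingD(1,2)[OF S, of \<omega>] by auto
  next
    fix s :: real assume s: "0 \<le> s"
    have "{\<omega>\<in>space M. R n \<omega> \<le> s} = {\<omega>\<in>space M. S \<omega> \<le> s} \<union> {\<omega>\<in>space (F s). T n \<omega> \<le> ennreal s}"
      using R_le[OF s] space_F[OF s] by auto
    moreover have "{\<omega>\<in>space (F s). T n \<omega> \<le> ennreal s} \<in> sets (F s)"
      using T[of n] s unfolding ext_stopping_time_def pred_def by blast
    ultimately show "{\<omega>\<in>space M. R n \<omega> \<le> s} \<in> sets (F s)"
      using bounded_stoppingD(3)[OF S s] by (simp only: sets.Un)
  qed
  have "mean_balanced (R n)" for n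
  proof -
    let ?Z = "\<lambda>\<omega>. stopped (\<lambda>t \<omega>. N t \<omega> - N 0 \<omega>) (T n) (S \<omega>) \<omega>"
    note opt = martingale_optional_finite[OF mart[of n] S fin]
    have "(\<integral>\<omega>. ?Z \<omega> \<partial>M) = 0"
    proof -
      have "stopped (\<lambda>t \<omega>. N t \<omega> - N 0 \<omega>) (T n) 0 = (\<lambda>\<omega>. 0)"
        by (simp add: fun_eq_iff stopped_def)
      then show ?thesis unfolding opt(2) by simp
    qed
    have Z: "?Z \<omega> = N (R n \<omega>) \<omega> - N 0 \<omega>" for \<omega>
      unfolding stopped_def R_def by simp
    \<comment> \<open>Neither measurability nor integrability of \<open>A\<close> at
      \<open>R n\<close> is known beforehand; both are read off from this almost sure difference,
      with \<open>X\<close> integrable by class (D) and the stopped martingale by optional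
      stopping.\<close>
    have eq: "AE \<omega> in M. X (R n \<omega>) \<omega> - ?Z \<omega> = A (R n \<omega>) \<omega>"
      using X_eq N_0
    proof eventually_elim
      case (elim \<omega>)
      then show ?case using bounded_stoppingD(1)[OF R, of n \<omega>] unfolding Z by simp
    qed
    have int: "integrable M (\<lambda>\<omega>. X (R n \<omega>) \<omega> - ?Z \<omega>)"
      using X_stopped_integrable[OF R] opt(1) by simp
    have meas: "(\<lambda>\<omega>. A (R n \<omega>) \<omega>) \<in> borel_measurable M"
      by (rule measurable_AE_eq[OF borel_measurable_integrable[OF int] _ eq]) auto
    have "integrable M (\<lambda>\<omega>. A (R n \<omega>) \<omega>)"
      by (rule integrable_cong_AE_imp[OF int meas]) (use eq in eventually_elim, simp)
    moreover have "(\<integral>\<omega>. A (R n \<omega>) \<omega> \<partial>M) = (\<integral>\<omega>. X (R n \<omega>) \<omega> - ?Z \<omega> \<partial>M)"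
      by (rule integral_cong_AE[OF meas borel_measurable_integrable[OF int]]) (use eq in eventually_elim, simp)
    moreover have "\<dots> = (\<integral>\<omega>. X (R n \<omega>) \<omega> \<partial>M)"
      using X_stopped_integrable[OF R] opt(1) \<open>(\<integral>\<omega>. ?Z \<omega> \<partial>M) = 0\<close> by simp
    ultimately show ?thesis unfolding mean_balanced_def by simp
  qed
  moreover have "AE \<omega> in M. \<forall>\<^sub>F n in sequentially. R n \<omega> = S \<omega>"
    using T_lim
  proof eventually_elim
    case (elim \<omega>)
    then have "\<forall>\<^sub>F n in sequentially. ennreal (S \<omega>) < T n \<omega>"
      by (rule order_tendstoD) simp
    then show ?case
      by eventually_elim (use bounded_stoppingD(1)[OF S] in \<open>simp add: R_def min_absorb1\<close>)
  qed
  ultimately show thesis using R that by blast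
qed

text \<open>Class (D) bounds the means of \<open>X\<close> at all stopping times at once. Along
  localising times for the constant time \<open>t\<close> the means of \<open>A\<close> equal those
  of \<open>X\<close>, and Fatou carries the bound over to \<open>A t\<close>, with a constant that
  does not depend on \<open>t\<close>.\<close>

lemma moment_bound:
  obtains C where "0 \<le> C" "\<And>t. 0 \<le> t \<Longrightarrow> (\<integral>\<^sup>+\<omega>. ennreal (A t \<omega>) \<partial>M) \<le> ennreal C"
    "\<And>S t. bounded_stopping S t \<Longrightarrow> (\<integral>\<^sup>+\<omega>. ennreal (X (S \<omega>) \<omega>) \<partial>M) \<le> ennreal C"
proof -
  obtain C where C: "0 \<le> C" "\<And>Y. Y \<in> stopped_values \<Longrightarrow> (\<integral>\<^sup>+\<omega>. ennreal \<bar>Y \<omega>\<bar> \<partial>M) \<le> ennreal C"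
    using uniformly_integrable_bounded[OF UI] by blast
  have X_bound: "(\<integral>\<^sup>+\<omega>. ennreal (X (S \<omega>) \<omega>) \<partial>M) \<le> ennreal C" if S: "bounded_stopping S t" for S t
  proof -
    have "(\<integral>\<^sup>+\<omega>. ennreal (X (S \<omega>) \<omega>) \<partial>M) \<le> (\<integral>\<^sup>+\<omega>. ennreal \<bar>X (S \<omega>) \<omega>\<bar> \<partial>M)"
      by (intro nn_integral_mono ennreal_leI) simp
    also have "\<dots> \<le> ennreal C" using stopped_value[OF S] by (rule C(2))
    finally show ?thesis .
  qed
  have A_bound: "(\<integral>\<^sup>+\<omega>. ennreal (A t \<omega>) \<partial>M) \<le> ennreal C" if t: "0 \<le> t" for t
  proof -
    obtain R where R: "\<And>n. bounded_stopping (R n) t" "\<And>n. mean_balanced (R n)"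
        "AE \<omega> in M. \<forall>\<^sub>F n in sequentially. R n \<omega> = t"
      by (rule localised_balanced[OF bounded_stopping_const[OF t order_refl]]) auto
    have R_bound: "(\<integral>\<^sup>+\<omega>. ennreal (A (R n \<omega>) \<omega>) \<partial>M) \<le> ennreal C" for n
    proof -
      have "(\<integral>\<^sup>+\<omega>. ennreal (A (R n \<omega>) \<omega>) \<partial>M) = ennreal (\<integral>\<omega>. A (R n \<omega>) \<omega> \<partial>M)"
      proof (rule nn_integral_eq_integral)
        show "AE \<omega> in M. 0 \<le> A (R n \<omega>) \<omega>"
          using A_nonneg by eventually_elim (use bounded_stoppingD(1)[OF R(1)] in auto)
      qed (use R(2) in \<open>simp add: mean_balanced_def\<close>)
      also have "\<dots> = ennreal (\<integral>\<omega>. X (R n \<omega>) \<omega> \<partial>M)" using R(2) by (simp add: mean_balanced_def)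
      also have "\<dots> = (\<integral>\<^sup>+\<omega>. ennreal (X (R n \<omega>) \<omega>) \<partial>M)"
      proof (rule nn_integral_eq_integral[symmetric])
        show "AE \<omega> in M. 0 \<le> X (R n \<omega>) \<omega>"
          using X_nonneg by eventually_elim (use bounded_stoppingD(1)[OF R(1)] in auto)
      qed (rule X_stopped_integrable[OF R(1)])
      also have "\<dots> \<le> ennreal C" using R(1) by (rule X_bound)
      finally show ?thesis .
    qed
    have "(\<integral>\<^sup>+\<omega>. ennreal (A t \<omega>) \<partial>M) = (\<integral>\<^sup>+\<omega>. liminf (\<lambda>n. ennreal (A (R n \<omega>) \<omega>)) \<partial>M)"
    proof (rule nn_integral_cong_AE, use R(3) in eventually_elim)
      fix \<omega> assume "\<forall>\<^sub>F n in sequentially. R n \<omega> = t"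
      then have "\<forall>\<^sub>F n in sequentially. ennreal (A (R n \<omega>) \<omega>) = ennreal (A t \<omega>)"
        by eventually_elim simp
      then have "(\<lambda>n. ennreal (A (R n \<omega>) \<omega>)) \<longlonglongrightarrow> ennreal (A t \<omega>)" by (rule tendsto_eventually)
      then show "ennreal (A t \<omega>) = liminf (\<lambda>n. ennreal (A (R n \<omega>) \<omega>))"
        by (simp add: lim_imp_Liminf)
    qed
    also have "\<dots> \<le> liminf (\<lambda>n. \<integral>\<^sup>+\<omega>. ennreal (A (R n \<omega>) \<omega>) \<partial>M)"
    proof (rule nn_integral_liminf)
      fix n
      have "(\<lambda>\<omega>. A (R n \<omega>) \<omega>) \<in> borel_measurable M"
        using R(2)[of n] by (auto simp: mean_balanced_def)
      then show "(\<lambda>\<omega>. ennreal (A (R n \<omega>) \<omega>)) \<in> borel_measurable M" by simp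
    qed
    also have "\<dots> \<le> liminf (\<lambda>n::nat. ennreal C)" using R_bound by (intro Liminf_mono) auto
    also have "\<dots> = ennreal C" by (rule Liminf_const) simp
    finally show ?thesis .
  qed
  show thesis by (rule that[OF C(1) A_bound X_bound])
qed

lemma A_integrable:
  assumes t: "0 \<le> t" shows "integrable M (A t)"
proof (rule integrableI_nonneg)
  show "A t \<in> borel_measurable M" by (rule A_measurable[OF t])
  show "AE \<omega> in M. 0 \<le> A t \<omega>" using A_nonneg by eventually_elim (use t in auto)
  obtain C where "\<And>t. 0 \<le> t \<Longrightarrow> (\<integral>\<^sup>+\<omega>. ennreal (A t \<omega>) \<partial>M) \<le> ennreal C"
    by (rule moment_bound) blast
  from this[OF t] show "(\<integral>\<^sup>+\<omega>. ennreal (A t \<omega>) \<partial>M) < \<infinity>" by (rule le_less_trans) simp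
qed

text \<open>The two sides need different limit theorems: \<open>A\<close> at times up to
  \<open>t\<close> is dominated by the integrable \<open>A t\<close>, whereas \<open>X\<close> has
  no integrable majorant and is handled by uniform integrability.\<close>

lemma mean_balanced_limit:
  assumes R: "\<And>n. bounded_stopping (R n) t" "\<And>n. mean_balanced (R n)" and S: "bounded_stopping S t"
    and lim: "AE \<omega> in M. (\<lambda>n. X (R n \<omega>) \<omega>) \<longlonglongrightarrow> X (S \<omega>) \<omega>" "AE \<omega> in M. (\<lambda>n. A (R n \<omega>) \<omega>) \<longlonglongrightarrow> A (S \<omega>) \<omega>"
  shows "mean_balanced S"
proof -
  have t: "0 \<le> t" using bounded_stoppingD(1,2)[OF S] order_trans by blast
  have R_meas: "(\<lambda>\<omega>. A (R n \<omega>) \<omega>) \<in> borel_measurable M" for n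
    using R(2) by (auto simp: mean_balanced_def)
  have S_meas: "(\<lambda>\<omega>. A (S \<omega>) \<omega>) \<in> borel_measurable M"
    using borel_measurable_AE_limit[OF R_meas lim(2)] .
  have dom: "AE \<omega> in M. norm (A (R n \<omega>) \<omega>) \<le> A t \<omega>" for n
    using A_mono A_nonneg
    by eventually_elim (use bounded_stoppingD(1,2)[OF R(1)] in auto)
  have conv: "(\<lambda>n. \<integral>\<omega>. A (R n \<omega>) \<omega> \<partial>M) \<longlonglongrightarrow> (\<integral>\<omega>. A (S \<omega>) \<omega> \<partial>M)"
    by (rule integral_dominated_convergence[OF S_meas R_meas A_integrable[OF t] lim(2) dom])
  have "(\<lambda>n. \<integral>\<omega>. X (R n \<omega>) \<omega> \<partial>M) \<longlonglongrightarrow> (\<integral>\<omega>. X (S \<omega>) \<omega> \<partial>M)"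
    by (rule uniformly_integrable_limit(2)[OF UI stopped_value[OF R(1)] _ lim(1)])
      (rule borel_measurable_integrable[OF X_stopped_integrable[OF S]])
  moreover have "(\<integral>\<omega>. X (R n \<omega>) \<omega> \<partial>M) = (\<integral>\<omega>. A (R n \<omega>) \<omega> \<partial>M)" for n
    using R(2) by (simp add: mean_balanced_def)
  ultimately have "(\<integral>\<omega>. X (S \<omega>) \<omega> \<partial>M) = (\<integral>\<omega>. A (S \<omega>) \<omega> \<partial>M)"
    using LIMSEQ_unique[OF conv] by simp
  moreover have "integrable M (\<lambda>\<omega>. A (S \<omega>) \<omega>)"
    by (rule integrable_dominated_convergence[OF S_meas R_meas A_integrable[OF t] lim(2) dom])
  ultimately show ?thesis by (simp add: mean_balanced_def)
qed

lemma mean_balanced_finite: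
  assumes S: "bounded_stopping S t" and fin: "finite (range S)"
  shows "mean_balanced S"
proof -
  obtain R where R: "\<And>n. bounded_stopping (R n) t" "\<And>n. mean_balanced (R n)"
      "AE \<omega> in M. \<forall>\<^sub>F n in sequentially. R n \<omega> = S \<omega>"
    by (rule localised_balanced[OF S fin]) auto
  have "AE \<omega> in M. (\<lambda>n. Z (R n \<omega>) \<omega>) \<longlonglongrightarrow> Z (S \<omega>) \<omega>" for Z :: "real \<Rightarrow> 'a \<Rightarrow> real"
    using R(3)
  proof eventually_elim
    case (elim \<omega>)
    then show ?case by (intro tendsto_eventually) (auto elim: eventually_mono)
  qed
  from mean_balanced_limit[OF R(1,2) S this this] show ?thesis .
qed

text \<open>Grid times are finite valued, hence balanced, and approach \<open>S\<close> from the
  right, where both \<open>X\<close> and \<open>A\<close> are continuous.\<close>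

proposition optional_balanced:
  assumes S: "bounded_stopping S t"
  shows "mean_balanced S"
proof (rule mean_balanced_limit[OF _ _ S])
  show "bounded_stopping (\<lambda>\<omega>. grid t k (S \<omega>)) t" for k by (rule grid_stopping[OF S])
  then show "mean_balanced (\<lambda>\<omega>. grid t k (S \<omega>))" for k
    by (rule mean_balanced_finite) (rule grid_finite[OF S])
  show "AE \<omega> in M. (\<lambda>k. X (grid t k (S \<omega>)) \<omega>) \<longlonglongrightarrow> X (S \<omega>) \<omega>"
    using X_right_continuous
    by eventually_elim (use bounded_stoppingD(1,2)[OF S] in \<open>auto intro!: grid_right_continuous[where f = "\<lambda>s. X s _"]\<close>)
  show "AE \<omega> in M. (\<lambda>k. A (grid t k (S \<omega>)) \<omega>) \<longlonglongrightarrow> A (S \<omega>) \<omega>"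
    using A_right_continuous
    by eventually_elim (use bounded_stoppingD(1,2)[OF S] in \<open>auto intro!: grid_right_continuous[where f = "\<lambda>s. A s _"]\<close>)
qed

end

section \<open>Terminal values\<close>

text \<open>By Fatou the lower limit of the positive parts has finite mean, so it is finite almost
  surely. Boundedness along some subsequence is enough: it bounds a monotone path completely and
  excludes the limit \<infinity> for any other path.\<close>

lemma (in prob_space) AE_frequently_bounded:
  fixes Y :: "nat \<Rightarrow> 'a \<Rightarrow> real"
  assumes [measurable]: "\<And>n. Y n \<in> borel_measurable M"
    and C: "\<And>n. (\<integral>\<^sup>+\<omega>. ennreal (Y n \<omega>) \<partial>M) \<le> ennreal C"
  shows "AE \<omega> in M. \<exists>c. \<exists>\<^sub>F n in sequentially. Y n \<omega> \<le> c"
proof -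
  have "(\<integral>\<^sup>+\<omega>. liminf (\<lambda>n. ennreal (Y n \<omega>)) \<partial>M) \<le> liminf (\<lambda>n. \<integral>\<^sup>+\<omega>. ennreal (Y n \<omega>) \<partial>M)"
    by (rule nn_integral_liminf) measurable
  also have "\<dots> \<le> liminf (\<lambda>n::nat. ennreal C)" using C by (intro Liminf_mono) auto
  also have "\<dots> = ennreal C" by (rule Liminf_const) simp
  finally have "(\<integral>\<^sup>+\<omega>. liminf (\<lambda>n. ennreal (Y n \<omega>)) \<partial>M) \<noteq> \<infinity>" by (auto simp: top_unique)
  then have "AE \<omega> in M. liminf (\<lambda>n. ennreal (Y n \<omega>)) \<noteq> \<infinity>"
    by (intro nn_integral_PInf_AE) auto
  then show ?thesis
  proof eventually_elim
    case (elim \<omega>)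
    show ?case
    proof (rule ccontr)
      assume *: "\<nexists>c. \<exists>\<^sub>F n in sequentially. Y n \<omega> \<le> c"
      have "ennreal c \<le> liminf (\<lambda>n. ennreal (Y n \<omega>))" for c
      proof (rule Liminf_bounded)
        have "\<forall>\<^sub>F n in sequentially. \<not> Y n \<omega> \<le> c" using * by (simp add: not_frequently)
        then show "\<forall>\<^sub>F n in sequentially. ennreal c \<le> ennreal (Y n \<omega>)"
          by eventually_elim (auto intro: ennreal_leI)
      qed
      then have le: "of_nat k \<le> liminf (\<lambda>n. ennreal (Y n \<omega>))" for k :: nat
        by (metis ennreal_of_nat_eq_real_of_nat)
      obtain k :: nat where "liminf (\<lambda>n. ennreal (Y n \<omega>)) < of_nat k"
        using elim ennreal_Ex_less_of_nat[of "liminf (\<lambda>n. ennreal (Y n \<omega>))"] by (auto simp: less_top)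
      with le[of k] show False by simp
    qed
  qed
qed

lemma mono_on_frequently_bounded_converges:
  fixes f :: "real \<Rightarrow> real"
  assumes mono: "\<And>s t. \<lbrakk>0 \<le> s; s \<le> t\<rbrakk> \<Longrightarrow> f s \<le> f t"
    and freq: "\<exists>\<^sub>F n in sequentially. f (real n) \<le> c"
  obtains L where "(f \<longlongrightarrow> L) at_top" "\<And>t. 0 \<le> t \<Longrightarrow> f t \<le> L"
proof -
  have bound: "f t \<le> c" if "0 \<le> t" for t
  proof -
    obtain k :: nat where "t \<le> real k" using real_arch_simple by blast
    moreover obtain n where "k \<le> n" "f (real n) \<le> c"
      using freq unfolding frequently_sequentially by blast
    ultimately show ?thesis using mono[of t "real n"] that by auto
  qed
  have bdd: "bdd_above (f ` {0..})" using bound by (intro bdd_aboveI[of _ c]) auto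
  define L where "L = (SUP t\<in>{0..}. f t)"
  have le: "f t \<le> L" if "0 \<le> t" for t unfolding L_def using that by (intro cSUP_upper bdd) auto
  have "(f \<longlongrightarrow> L) at_top"
  proof (rule increasing_tendsto)
    show "\<forall>\<^sub>F t in at_top. f t \<le> L" using eventually_ge_at_top[of 0] by eventually_elim (rule le)
    fix y assume "y < L"
    then obtain s where s: "0 \<le> s" "y < f s"
      unfolding L_def using less_cSUP_iff[OF _ bdd] by auto
    show "\<forall>\<^sub>F t in at_top. y < f t"
      using eventually_ge_at_top[of s] by eventually_elim (use s mono in \<open>auto intro: less_le_trans\<close>)
  qed
  then show thesis using le by (rule that)
qed

text \<open>Unequal lower and upper limits could be separated by two numbers of type
  \<open>rat\<close>. Equality gives an extended limit, which \<open>freq\<close> keeps below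
  \<infinity> and nonnegativity above -\<infinity>. Rational levels leave only countably many
  exceptional null sets to be collected later.\<close>

lemma no_oscillation_converges:
  fixes f :: "real \<Rightarrow> real"
  assumes pos: "\<And>t. 0 \<le> t \<Longrightarrow> 0 \<le> f t"
    and freq: "\<exists>\<^sub>F n in sequentially. f (real n) \<le> c"
    and osc: "\<And>a b :: rat. a < b \<Longrightarrow>
      \<not> ((\<exists>\<^sub>F t in at_top. real_of_rat b < f t) \<and> (\<exists>\<^sub>F t in at_top. f t < real_of_rat a))"
  shows "\<exists>L. (f \<longlongrightarrow> L) at_top"
proof -
  let ?g = "\<lambda>t. ereal (f t)"
  have "Limsup at_top ?g \<le> Liminf at_top ?g"
  proof (rule ccontr)
    assume "\<not> ?thesis"
    then have "Liminf at_top ?g < Limsup at_top ?g" by simp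
    then obtain a where a: "Liminf at_top ?g < ereal (real_of_rat a)" "ereal (real_of_rat a) < Limsup at_top ?g"
      using ereal_dense3 by blast
    then obtain b where b: "ereal (real_of_rat a) < ereal (real_of_rat b)" "ereal (real_of_rat b) < Limsup at_top ?g"
      using ereal_dense3 by blast
    have "\<exists>\<^sub>F t in at_top. f t < real_of_rat a"
    proof (rule ccontr)
      assume "\<not> ?thesis"
      then have "\<forall>\<^sub>F t in at_top. ereal (real_of_rat a) \<le> ?g t"
        by (simp add: not_frequently not_less)
      then have "ereal (real_of_rat a) \<le> Liminf at_top ?g" by (rule Liminf_bounded)
      with a show False by simp
    qed
    moreover have "\<exists>\<^sub>F t in at_top. real_of_rat b < f t"
    proof (rule ccontr)
      assume "\<not> ?thesis"
      then have "\<forall>\<^sub>F t in at_top. ?g t \<le> ereal (real_of_rat b)"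
        by (simp add: not_frequently not_less)
      then have "Limsup at_top ?g \<le> ereal (real_of_rat b)" by (rule Limsup_bounded)
      with b show False by simp
    qed
    ultimately show False using osc[of a b] b(1) by (simp add: of_rat_less)
  qed
  then have eq: "Limsup at_top ?g = Liminf at_top ?g"
    by (intro antisym Liminf_le_Limsup) auto
  define L where "L = Liminf at_top ?g"
  have lim: "(?g \<longlongrightarrow> L) at_top"
    unfolding L_def using eq by (subst tendsto_iff_Liminf_eq_Limsup) auto
  have "L \<noteq> \<infinity>"
  proof
    assume "L = \<infinity>"
    have "((\<lambda>n. ?g (real n)) \<longlonglongrightarrow> L)"
      by (rule filterlim_compose[OF lim filterlim_real_sequentially])
    then have "\<forall>\<^sub>F n in sequentially. ereal c < ?g (real n)"
      using \<open>L = \<infinity>\<close> by (intro order_tendstoD) auto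
    with freq show False
      by (auto simp: frequently_def elim!: eventually_mono notE)
  qed
  moreover have "0 \<le> L"
    unfolding L_def
    by (rule Liminf_bounded) (use eventually_ge_at_top[of 0] in \<open>eventually_elim, use pos in auto\<close>)
  ultimately obtain r where "L = ereal r" by (cases L) auto
  with lim show ?thesis by auto
qed

text \<open>Induction on the generation of the sigma-algebra: complements leave the symmetric
  difference unchanged, and a countable union is close to a finite one, whose pieces can be
  approximated separately within one \<open>F n\<close>.\<close>

lemma (in usual_space) tail_event_approx:
  assumes B: "B \<in> sigma_sets (space M) (\<Union>n. sets (F (real n)))" and "0 < e"
  shows "\<exists>n. \<exists>C\<in>sets (F (real n)). prob ((B - C) \<union> (C - B)) < e"
proof -
  have F_M: "C \<in> sets M" if "C \<in> sets (F (real n))" for C n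
    using that sets_F_subset[of "real n"] by auto
  have B_M: "B \<in> sets M" if "B \<in> sigma_sets (space M) (\<Union>n. sets (F (real n)))" for B
    using that F_M by (intro sigma_sets_le_sets_iff[THEN iffD2, THEN subsetD]) auto
  from B \<open>0 < e\<close> show ?thesis
  proof (induction arbitrary: e)
    case (Basic B)
    then obtain n where "B \<in> sets (F (real n))" by blast
    then show ?case using Basic.prems by (intro exI[of _ n] bexI[of _ B]) auto
  next
    case Empty
    then show ?case by (intro exI[of _ 0] bexI[of _ "{}"]) auto
  next
    case (Compl B)
    then obtain n C where C: "C \<in> sets (F (real n))" "prob ((B - C) \<union> (C - B)) < e" by blast
    have "B \<subseteq> space M" "C \<subseteq> space M"
      using sets.sets_into_space[OF B_M[OF Compl.hyps]] sets.sets_into_space[OF F_M[OF C(1)]] by auto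
    then have "((space M - B) - (space M - C)) \<union> ((space M - C) - (space M - B)) = (B - C) \<union> (C - B)"
      by auto
    moreover have "space M - C \<in> sets (F (real n))"
      using sets.compl_sets[OF C(1)] space_F[of "real n"] by simp
    ultimately show ?case using C(2) by (intro exI[of _ n] bexI[of _ "space M - C"]) auto
  next
    case (Union B)
    have BM: "B i \<in> sets M" for i using B_M[OF Union.hyps(1)] .
    \<comment> \<open>Continuity of the measure from below: some finite union misses less than e / 2
      of the countable one.\<close>
    define U where "U k = (\<Union>i<k. B i)" for k
    have UM: "U k \<in> sets M" for k unfolding U_def using BM by auto
    have "incseq U" unfolding U_def incseq_def by (intro allI impI UN_mono) auto
    then have "(\<lambda>k. prob (U k)) \<longlonglongrightarrow> prob (\<Union>k. U k)"
      using UM by (intro finite_Lim_measure_incseq) auto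
    moreover have UB: "(\<Union>k. U k) = (\<Union>i. B i)" unfolding U_def by auto
    ultimately have "\<forall>\<^sub>F k in sequentially. prob (\<Union>i. B i) - e / 2 < prob (U k)"
      using \<open>0 < e\<close> by (intro order_tendstoD(1)) auto
    then obtain k where k: "prob (\<Union>i. B i) - e / 2 < prob (U k)"
      using eventually_happens'[OF sequentially_bot] by blast
    \<comment> \<open>Each of the k pieces may cost this much, in total at most e / 2; the successor
      allows k = 0.\<close>
    have "0 < e / (2 * real (Suc k))" using \<open>0 < e\<close> by simp
    then have "\<forall>i. \<exists>n C. C \<in> sets (F (real n)) \<and> prob ((B i - C) \<union> (C - B i)) < e / (2 * real (Suc k))"
      using Union.IH by blast
    then obtain n C where C: "\<And>i. C i \<in> sets (F (real (n i)))"
        "\<And>i. prob ((B i - C i) \<union> (C i - B i)) < e / (2 * real (Suc k))"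
      by metis
    \<comment> \<open>A common index for all k approximating events; the inserted 0 keeps the
      maximum defined for k = 0.\<close>
    define m where "m = Max (insert 0 (n ` {..<k}))"
    define D where "D = (\<Union>i<k. C i)"
    have "C i \<in> sets (F (real m))" if "i < k" for i
    proof -
      have "n i \<le> m" unfolding m_def using that by (intro Max_ge) auto
      then show ?thesis using C(1)[of i] sets_F_mono[of "real (n i)" "real m"] by auto
    qed
    then have D: "D \<in> sets (F (real m))" unfolding D_def by (intro sets.finite_UN) auto
    have CM: "C i \<in> sets M" for i using F_M C(1) by auto
    let ?E = "\<lambda>i. (B i - C i) \<union> (C i - B i)"
    have EM: "?E i \<in> sets M" for i using BM CM by auto
    have "((\<Union>i. B i) - D) \<union> (D - (\<Union>i. B i)) \<subseteq> ((\<Union>i. B i) - U k) \<union> (\<Union>i<k. ?E i)"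
      unfolding D_def U_def by auto
    then have "prob (((\<Union>i. B i) - D) \<union> (D - (\<Union>i. B i))) \<le> prob (((\<Union>i. B i) - U k) \<union> (\<Union>i<k. ?E i))"
      using BM UM EM by (intro finite_measure_mono) auto
    also have "\<dots> \<le> prob ((\<Union>i. B i) - U k) + prob (\<Union>i<k. ?E i)"
      using BM UM EM by (intro measure_Un_le) auto
    also have "prob ((\<Union>i. B i) - U k) = prob (\<Union>i. B i) - prob (U k)"
      using BM UM unfolding U_def by (intro finite_measure_Diff) auto
    also have "prob (\<Union>i<k. ?E i) \<le> (\<Sum>i<k. prob (?E i))"
      using EM by (intro measure_UNION_le) auto
    also have "\<dots> \<le> (\<Sum>i<k. e / (2 * real (Suc k)))" using C(2) by (intro sum_mono less_imp_le) auto
    also have "\<dots> = real k * (e / (2 * real (Suc k)))" by simp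
    also have "\<dots> \<le> e / 2" using \<open>0 < e\<close> by (simp add: field_simps)
    finally have "prob (((\<Union>i. B i) - D) \<union> (D - (\<Union>i. B i))) < e" using k by linarith
    with D show ?case by blast
  qed
qed

section \<open>Almost sure limits of \<open>A\<close> and of \<open>X\<close>\<close>

context sigma_D_process
begin

definition A_infty :: "'a \<Rightarrow> real" where "A_infty = terminal_value A"
definition X_infty :: "'a \<Rightarrow> real" where "X_infty = terminal_value X"

lemma A_tendsto: "AE \<omega> in M. ((\<lambda>t. A t \<omega>) \<longlongrightarrow> A_infty \<omega>) at_top \<and> (\<forall>t\<ge>0. A t \<omega> \<le> A_infty \<omega>)"
proof -
  obtain C where C: "\<And>t. 0 \<le> t \<Longrightarrow> (\<integral>\<^sup>+\<omega>. ennreal (A t \<omega>) \<partial>M) \<le> ennreal C"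
    by (rule moment_bound) auto
  have "AE \<omega> in M. \<exists>c. \<exists>\<^sub>F n in sequentially. A (real n) \<omega> \<le> c"
    by (rule AE_frequently_bounded[OF A_measurable C]) auto
  with A_mono show ?thesis
  proof eventually_elim
    case (elim \<omega>)
    then obtain c where "\<exists>\<^sub>F n in sequentially. A (real n) \<omega> \<le> c" by blast
    then obtain L where L: "((\<lambda>t. A t \<omega>) \<longlongrightarrow> L) at_top" "\<And>t. 0 \<le> t \<Longrightarrow> A t \<omega> \<le> L"
      using mono_on_frequently_bounded_converges[of "\<lambda>t. A t \<omega>" c] elim(1) by blast
    moreover have "A_infty \<omega> = L"
      unfolding A_infty_def terminal_value_def using L(1) by (intro tendsto_Lim) auto
    ultimately show ?case by simp
  qed
qed

lemma A_tendsto_nat: "AE \<omega> in M. (\<lambda>n. A (real n) \<omega>) \<longlonglongrightarrow> A_infty \<omega>"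
  using A_tendsto
proof eventually_elim
  case (elim \<omega>)
  then show ?case by (intro filterlim_compose[OF _ filterlim_real_sequentially, of "\<lambda>t. A t \<omega>"]) auto
qed

lemma A_infty_nonneg: "AE \<omega> in M. 0 \<le> A_infty \<omega>"
  using A_tendsto A_nonneg
proof eventually_elim
  case (elim \<omega>)
  then have "0 \<le> A 0 \<omega>" "A 0 \<omega> \<le> A_infty \<omega>" by auto
  then show ?case by simp
qed

lemma A_infty_measurable: "A_infty \<in> borel_measurable M"
  using borel_measurable_AE_limit[OF A_measurable A_tendsto_nat] by simp

lemma A_infty_integrable: "integrable M A_infty"
proof (rule integrableI_nonneg)
  show "A_infty \<in> borel_measurable M" by (rule A_infty_measurable)
  show "AE \<omega> in M. 0 \<le> A_infty \<omega>" by (rule A_infty_nonneg)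
  obtain C where C: "\<And>t. 0 \<le> t \<Longrightarrow> (\<integral>\<^sup>+\<omega>. ennreal (A t \<omega>) \<partial>M) \<le> ennreal C"
    by (rule moment_bound) auto
  have "(\<integral>\<^sup>+\<omega>. ennreal (A_infty \<omega>) \<partial>M) = (\<integral>\<^sup>+\<omega>. liminf (\<lambda>n. ennreal (A (real n) \<omega>)) \<partial>M)"
  proof (rule nn_integral_cong_AE, use A_tendsto_nat in eventually_elim)
    fix \<omega> assume "(\<lambda>n. A (real n) \<omega>) \<longlonglongrightarrow> A_infty \<omega>"
    then show "ennreal (A_infty \<omega>) = liminf (\<lambda>n. ennreal (A (real n) \<omega>))"
      by (intro lim_imp_Liminf[symmetric] tendsto_ennrealI) auto
  qed
  also have "\<dots> \<le> liminf (\<lambda>n. \<integral>\<^sup>+\<omega>. ennreal (A (real n) \<omega>) \<partial>M)"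
    by (rule nn_integral_liminf) (use A_measurable in auto)
  also have "\<dots> \<le> liminf (\<lambda>n::nat. ennreal C)" using C by (intro Liminf_mono) auto
  also have "\<dots> = ennreal C" by (rule Liminf_const) simp
  also have "\<dots> < \<infinity>" by simp
  finally show "(\<integral>\<^sup>+\<omega>. ennreal (A_infty \<omega>) \<partial>M) < \<infinity>" .
qed

text \<open>By balance the difference equals \<open>E[A_S] - E[A_T]\<close>. Since \<open>A\<close>
  at \<open>S\<close> is at most \<open>A_infty\<close> and \<open>A\<close> at \<open>T\<close> is
  at least \<open>A (real m)\<close>, it is at most \<open>E[A_infty - A_m]\<close>, which tends to
  0 by dominated convergence. The bound k \<le> m leaves room for an event already chosen at time
  k.\<close>

lemma A_increment_small:
  assumes "0 < e"
  obtains m :: nat where "k \<le> m"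
    "\<And>S T n. \<lbrakk>bounded_stopping S (real n); bounded_stopping T (real n); \<And>\<omega>. real m \<le> T \<omega>\<rbrakk> \<Longrightarrow>
      (\<integral>\<omega>. X (S \<omega>) \<omega> \<partial>M) - (\<integral>\<omega>. X (T \<omega>) \<omega> \<partial>M) \<le> e"
proof -
  have "(\<lambda>n. \<integral>\<omega>. A (real n) \<omega> \<partial>M) \<longlonglongrightarrow> (\<integral>\<omega>. A_infty \<omega> \<partial>M)"
  proof (rule integral_dominated_convergence[OF A_infty_measurable A_measurable A_infty_integrable A_tendsto_nat])
    show "AE \<omega> in M. norm (A (real n) \<omega>) \<le> A_infty \<omega>" for n
      using A_tendsto A_nonneg by eventually_elim simp
  qed simp
  then have "\<forall>\<^sub>F n in sequentially. (\<integral>\<omega>. A_infty \<omega> \<partial>M) - e < (\<integral>\<omega>. A (real n) \<omega> \<partial>M)"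
    using assms by (intro order_tendstoD(1)) auto
  moreover have "\<forall>\<^sub>F n in sequentially. k \<le> n" by (rule eventually_ge_at_top)
  ultimately have "\<forall>\<^sub>F n in sequentially. k \<le> n \<and> (\<integral>\<omega>. A_infty \<omega> \<partial>M) - e < (\<integral>\<omega>. A (real n) \<omega> \<partial>M)"
    by eventually_elim simp
  then obtain m where m: "k \<le> m" "(\<integral>\<omega>. A_infty \<omega> \<partial>M) - e < (\<integral>\<omega>. A (real m) \<omega> \<partial>M)"
    using eventually_happens'[OF sequentially_bot] by blast
  have "(\<integral>\<omega>. X (S \<omega>) \<omega> \<partial>M) - (\<integral>\<omega>. X (T \<omega>) \<omega> \<partial>M) \<le> e"
    if S: "bounded_stopping S (real n)" and T: "bounded_stopping T (real n)" and ge: "\<And>\<omega>. real m \<le> T \<omega>" for S T n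
  proof -
    note bal = optional_balanced[OF S] optional_balanced[OF T]
    have "(\<integral>\<omega>. A (S \<omega>) \<omega> \<partial>M) \<le> (\<integral>\<omega>. A_infty \<omega> \<partial>M)"
    proof (rule integral_mono_AE[OF _ A_infty_integrable])
      show "AE \<omega> in M. A (S \<omega>) \<omega> \<le> A_infty \<omega>"
        using A_tendsto by eventually_elim (use bounded_stoppingD(1)[OF S] in auto)
    qed (use bal in \<open>simp add: mean_balanced_def\<close>)
    moreover have "(\<integral>\<omega>. A (real m) \<omega> \<partial>M) \<le> (\<integral>\<omega>. A (T \<omega>) \<omega> \<partial>M)"
    proof (rule integral_mono_AE[OF A_integrable])
      show "AE \<omega> in M. A (real m) \<omega> \<le> A (T \<omega>) \<omega>"
        using A_mono by eventually_elim (use ge in auto)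
    qed (use bal in \<open>simp_all add: mean_balanced_def\<close>)
    ultimately show ?thesis using bal m(2) by (simp add: mean_balanced_def)
  qed
  with m(1) show thesis by (rule that)
qed

text \<open>After a late time m compare the entrance time above b with the entrance time below a,
  both restricted to an event \<open>C\<close> of \<open>F (real m)\<close> close to the oscillation
  event \<open>B\<close>. Where both entrances happen, the difference of the stopped values is at
  least b - a; the mean difference is at most e. Which entrance comes first is immaterial.\<close>

lemma oscillation_null:
  fixes a b :: real
  assumes ab: "a < b"
  shows "AE \<omega> in M. \<not> ((\<exists>\<^sub>F t in at_top. b < X t \<omega>) \<and> (\<exists>\<^sub>F t in at_top. X t \<omega> < a))"
proof -
  define V where "V U n = (\<Union>q\<in>\<rat> \<inter> {real n..}. {\<omega>\<in>space M. X q \<omega> \<in> U})" for U and n :: nat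
  \<comment> \<open>Oscillation along rational times, a countable description that places
    \<open>B\<close> in the sigma-algebra generated by the filtration; right continuity of the paths
    recovers real times at the end.\<close>
  define B where "B = (\<Inter>n. V {b<..} n) \<inter> (\<Inter>n. V {..<a} n)"
  have B_sigma: "B \<in> sigma_sets (space M) (\<Union>n. sets (F (real n)))"
  proof -
    let ?G = "sigma (space M) (\<Union>n. sets (F (real n)))"
    have pow: "(\<Union>n. sets (F (real n))) \<subseteq> Pow (space M)"
    proof (rule UN_least)
      show "sets (F (real n)) \<subseteq> Pow (space M)" for n
        using sets.space_closed[of "F (real n)"] space_F[of "real n"] by simp
    qed
    have G: "sets ?G = sigma_sets (space M) (\<Union>n. sets (F (real n)))" using pow by simp
    have "V U n \<in> sets ?G" if U: "open U" for U n
      unfolding V_def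
    proof (rule sets.countable_UN'[OF countable_Int1[OF countable_rat] image_subsetI])
      fix q assume "q \<in> \<rat> \<inter> {real n..}"
      then have q0: "0 \<le> q" by auto
      obtain j :: nat where j: "q \<le> real j" using real_arch_simple by blast
      have "X q \<in> borel_measurable (F q)" using adapted_X q0 by (auto simp: adapted_def)
      from measurable_sets[OF this, of U] U have "{\<omega>\<in>space M. X q \<omega> \<in> U} \<in> sets (F q)"
        by (simp add: space_F[OF q0] vimage_def Int_def conj_commute)
      then have "{\<omega>\<in>space M. X q \<omega> \<in> U} \<in> sets (F (real j))" using sets_F_mono[OF q0 j] by blast
      then show "{\<omega>\<in>space M. X q \<omega> \<in> U} \<in> sets ?G"
        unfolding G by (intro sigma_sets.Basic) blast
    qed
    then have "B \<in> sets ?G" unfolding B_def by (intro sets.Int sets.countable_INT) auto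
    then show ?thesis unfolding G .
  qed
  have BM [measurable]: "B \<in> sets M"
  proof -
    have "(\<Union>n. sets (F (real n))) \<subseteq> sets M"
      by (rule UN_least) (rule sets_F_subset, simp)
    from sets.sigma_sets_subset[OF this] B_sigma show ?thesis by blast
  qed
  have small: "prob B \<le> e * (1 + 2 / (b - a))" if e: "0 < e" for e
  proof -
    obtain d where d: "0 < d" "\<And>Y D. \<lbrakk>Y \<in> stopped_values; D \<in> sets M; prob D < d\<rbrakk> \<Longrightarrow>
        (\<integral>\<omega>. indicator D \<omega> * \<bar>Y \<omega>\<bar> \<partial>M) \<le> e"
      using uniformly_integrable_abs_cont[OF UI e] by blast
    \<comment> \<open>Two errors below d' occur together twice: their sum must be below d for the
      absolute continuity bound, and below e in the final estimate of \<open>prob B\<close>.\<close>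
    define d' where "d' = min d e / 2"
    have d': "0 < d'" "2 * d' \<le> d" "2 * d' \<le> e" using d(1) e by (auto simp: d'_def)
    obtain k C where C: "C \<in> sets (F (real k))" and BC: "prob ((B - C) \<union> (C - B)) < d'"
      using tail_event_approx[OF B_sigma d'(1)] by blast
    have CM [measurable]: "C \<in> sets M" using C sets_F_subset[of "real k"] by auto
    obtain m where m: "k \<le> m" "\<And>S T n. \<lbrakk>bounded_stopping S (real n); bounded_stopping T (real n);
        \<And>\<omega>. real m \<le> T \<omega>\<rbrakk> \<Longrightarrow> (\<integral>\<omega>. X (S \<omega>) \<omega> \<partial>M) - (\<integral>\<omega>. X (T \<omega>) \<omega> \<partial>M) \<le> e"
      using A_increment_small[OF e, of k] by blast
    have Cm: "C \<in> sets (F (real m))" using C m(1) sets_F_mono[of "real k" "real m"] by auto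
    define up where "up n = hit X {b<..} C (real m) (real n)" for n :: nat
    define down where "down n = hit X {..<a} C (real m) (real n)" for n :: nat
    have up: "bounded_stopping (up n) (real n)" and down: "bounded_stopping (down n) (real n)"
      if "m \<le> n" for n
      unfolding up_def down_def
      using that by (auto intro!: hit_stopping[OF adapted_X X_right_continuous _ _ _ Cm])
    define H where "H n = {\<omega>\<in>C. up n \<omega> < real n \<and> down n \<omega> < real n}" for n
    have HM: "H n \<in> sets M" if "m \<le> n" for n
    proof -
      have [measurable]: "up n \<in> borel_measurable M" "down n \<in> borel_measurable M"
        using bounded_stopping_measurable[OF up[OF that]] bounded_stopping_measurable[OF down[OF that]] by auto
      show ?thesis unfolding H_def by measurable
    qed
    have H_ev: "\<forall>\<^sub>F n in sequentially. \<omega> \<in> H n" if \<omega>: "\<omega> \<in> B" "\<omega> \<in> C" for \<omega>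
    proof -
      obtain q where q: "real m \<le> q" "b < X q \<omega>" using \<omega>(1) by (auto simp: B_def V_def)
      obtain r where r: "real m \<le> r" "X r \<omega> < a" using \<omega>(1) by (auto simp: B_def V_def)
      obtain j :: nat where j: "max q r < real j" using reals_Archimedean2 by blast
      show ?thesis
        using eventually_ge_at_top[of j]
      proof eventually_elim
        case (elim n)
        then have n: "q < real n" "r < real n" "real m \<le> real n" using j q by auto
        show ?case unfolding H_def up_def down_def
          using \<omega>(2) q r n by (auto simp: hit_less_iff[OF n(3) order_refl])
      qed
    qed
    have ind: "(\<lambda>n. indicat_real (B \<inter> C - H n) \<omega>) \<longlonglongrightarrow> 0" for \<omega>
    proof (rule tendsto_eventually)
      show "\<forall>\<^sub>F n in sequentially. indicat_real (B \<inter> C - H n) \<omega> = 0"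
      proof (cases "\<omega> \<in> B \<inter> C")
        case True
        then have "\<forall>\<^sub>F n in sequentially. \<omega> \<in> H n" using H_ev by blast
        then show ?thesis by eventually_elim simp
      next
        case False
        then have "indicat_real (B \<inter> C - H n) \<omega> = 0" for n by (auto split: split_indicator)
        then show ?thesis by (intro always_eventually allI)
      qed
    qed
    \<comment> \<open>The shift by m restricts to indices for which \<open>H\<close> is known to be
      measurable.\<close>
    have "(\<lambda>n. \<integral>\<omega>. indicat_real (B \<inter> C - H (n + m)) \<omega> \<partial>M) \<longlonglongrightarrow> (\<integral>\<omega>. 0 \<partial>M)"
    proof (rule integral_dominated_convergence[where w = "\<lambda>_. 1"])
      show "AE \<omega> in M. (\<lambda>n. indicat_real (B \<inter> C - H (n + m)) \<omega>) \<longlonglongrightarrow> 0"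
        using ind by (intro AE_I2 LIMSEQ_ignore_initial_segment) auto
    qed (use HM BM CM in \<open>auto split: split_indicator\<close>)
    moreover have "(\<integral>\<omega>. indicat_real (B \<inter> C - H (n + m)) \<omega> \<partial>M) = prob (B \<inter> C - H (n + m))" for n
      using HM[of "n + m"] by simp
    ultimately have "(\<lambda>n. prob (B \<inter> C - H (n + m))) \<longlonglongrightarrow> 0" by simp
    then have "\<forall>\<^sub>F n in sequentially. prob (B \<inter> C - H (n + m)) < d'" using d'(1) by (rule order_tendstoD(2))
    then obtain n0 where n0: "prob (B \<inter> C - H (n0 + m)) < d'"
      using eventually_happens'[OF sequentially_bot] by blast
    define n where "n = n0 + m"
    have n: "m \<le> n" "prob (B \<inter> C - H n) < d'" using n0 by (auto simp: n_def)
    note HMn [measurable] = HM[OF n(1)]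
    have BC': "prob (C - B) < d'" "prob (B - C) < d'"
      using finite_measure_mono[of "C - B" "(B - C) \<union> (C - B)"]
        finite_measure_mono[of "B - C" "(B - C) \<union> (C - B)"] BC by auto
    have CH: "prob (C - H n) < d"
    proof -
      have "prob (C - H n) \<le> prob ((C - B) \<union> (B \<inter> C - H n))" by (rule finite_measure_mono) auto
      also have "\<dots> \<le> prob (C - B) + prob (B \<inter> C - H n)" by (rule measure_Un_le) auto
      also have "\<dots> < d" using n(2) BC' d' by linarith
      finally show ?thesis .
    qed
    \<comment> \<open>On \<open>H n\<close> the gain is b - a by right continuity at the entrances.
      On the rest of \<open>C\<close> nonnegativity of \<open>X\<close> limits the loss to the value
      at \<open>down n\<close>, whose mean there is small because that set is small. Outside
      \<open>C\<close> the two times coincide.\<close>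
    have pointwise: "AE \<omega> in M. (b - a) * indicator (H n) \<omega> - indicator (C - H n) \<omega> * \<bar>X (down n \<omega>) \<omega>\<bar>
        \<le> X (up n \<omega>) \<omega> - X (down n \<omega>) \<omega>"
      using X_nonneg X_right_continuous
    proof eventually_elim
      case (elim \<omega>)
      have mn: "0 \<le> real m" "real m \<le> real n" using n(1) by auto
      consider "\<omega> \<in> H n" | "\<omega> \<in> C - H n" | "\<omega> \<notin> C" by blast
      then show ?case
      proof cases
        case 1
        then have "up n \<omega> < real n" "down n \<omega> < real n" by (auto simp: H_def)
        then have "X (up n \<omega>) \<omega> \<in> closure {b<..}" "X (down n \<omega>) \<omega> \<in> closure {..<a}"
          unfolding up_def down_def using elim(2) by (intro hit_closure[where Z = X, OF mn]; auto)+
        then show ?thesis using 1 by simp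
      next
        case 2
        have "0 \<le> X (up n \<omega>) \<omega>" using elim(1) bounded_stoppingD(1)[OF up[OF n(1)]] by auto
        then show ?thesis using 2 by simp
      next
        case 3
        then have "up n \<omega> = down n \<omega>" unfolding up_def down_def hit_def by simp
        moreover have "\<omega> \<notin> H n" using 3 by (auto simp: H_def)
        ultimately show ?thesis using 3 by simp
      qed
    qed
    note up_int = X_stopped_integrable[OF up[OF n(1)]] and down_int = X_stopped_integrable[OF down[OF n(1)]]
    have ind_int: "integrable M (\<lambda>\<omega>. indicator (C - H n) \<omega> * \<bar>X (down n \<omega>) \<omega>\<bar>)"
      using integrable_real_mult_indicator[OF _ integrable_abs[OF down_int], of "C - H n"] by (simp add: mult.commute)
    have H_int: "integrable M (\<lambda>\<omega>. (b - a) * indicat_real (H n) \<omega>)" by (simp add: emeasure_eq_measure)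
    have "(\<integral>\<omega>. (b - a) * indicator (H n) \<omega> - indicator (C - H n) \<omega> * \<bar>X (down n \<omega>) \<omega>\<bar> \<partial>M)
        \<le> (\<integral>\<omega>. X (up n \<omega>) \<omega> - X (down n \<omega>) \<omega> \<partial>M)"
      using up_int down_int ind_int H_int pointwise by (intro integral_mono_AE) auto
    also have "\<dots> = (\<integral>\<omega>. X (up n \<omega>) \<omega> \<partial>M) - (\<integral>\<omega>. X (down n \<omega>) \<omega> \<partial>M)"
      using up_int down_int by simp
    also have "\<dots> \<le> e"
      using n(1) by (intro m(2)[OF up[OF n(1)] down[OF n(1)]]) (auto simp: down_def intro: hit_bounds)
    finally have "(b - a) * prob (H n) - (\<integral>\<omega>. indicator (C - H n) \<omega> * \<bar>X (down n \<omega>) \<omega>\<bar> \<partial>M) \<le> e"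
      using ind_int H_int by simp
    moreover have "(\<integral>\<omega>. indicator (C - H n) \<omega> * \<bar>X (down n \<omega>) \<omega>\<bar> \<partial>M) \<le> e"
      by (rule d(2)[OF stopped_value[OF down[OF n(1)]] _ CH]) simp
    ultimately have "(b - a) * prob (H n) \<le> 2 * e" by simp
    then have PH: "prob (H n) \<le> 2 * e / (b - a)" using ab by (simp add: pos_le_divide_eq mult.commute)
    have "prob B \<le> prob ((B - C) \<union> ((B \<inter> C - H n) \<union> H n))" by (rule finite_measure_mono) auto
    also have "\<dots> \<le> prob (B - C) + prob ((B \<inter> C - H n) \<union> H n)" by (rule measure_Un_le) auto
    also have "\<dots> \<le> prob (B - C) + (prob (B \<inter> C - H n) + prob (H n))"
      by (intro add_left_mono measure_Un_le) auto
    also have "\<dots> \<le> e + 2 * e / (b - a)" using PH n(2) BC'(2) d'(3) by linarith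
    also have "\<dots> = e * (1 + 2 / (b - a))" by (simp add: algebra_simps)
    finally show ?thesis .
  qed
  have "prob B \<le> 0"
  proof (rule field_le_epsilon)
    fix e :: real assume "0 < e"
    define c where "c = 1 + 2 / (b - a)"
    have "0 < c" using ab by (auto simp: c_def intro: add_pos_pos)
    then show "prob B \<le> 0 + e" using small[of "e / c"] \<open>0 < e\<close> by (simp add: c_def[symmetric])
  qed
  then have "prob B = 0" by (simp add: measure_le_0_iff)
  then have "AE \<omega> in M. \<omega> \<notin> B" by (intro AE_not_in) (simp add: null_setsI emeasure_eq_measure)
  then show ?thesis
    using X_right_continuous AE_space
  proof eventually_elim
    case (elim \<omega>)
    \<comment> \<open>A visit to the open set at a real time is followed by one at a rational
      time.\<close>
    have "\<omega> \<in> V U n" if U: "open U" and fr: "\<exists>\<^sub>F t in at_top. X t \<omega> \<in> U" for U n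
    proof -
      have "\<exists>\<^sub>F t in at_top. X t \<omega> \<in> U \<and> real n \<le> t"
        using fr eventually_ge_at_top[of "real n"] by (rule frequently_eventually_frequently)
      then obtain s where s: "real n \<le> s" "X s \<omega> \<in> U" by (auto dest!: frequently_ex)
      have "((\<lambda>s. X s \<omega>) \<longlongrightarrow> X s \<omega>) (at_right s)" using elim(2) s(1) by auto
      then obtain q where "q \<in> \<rat>" "s < q" "X q \<omega> \<in> U"
        using right_continuous_rational_witness[of "\<lambda>s. X s \<omega>" s U "s + 1"] U s(2) by auto
      then show ?thesis using elim(3) s(1) by (auto simp: V_def)
    qed
    from this[of "{b<..}"] this[of "{..<a}"] elim(1) show ?case by (auto simp: B_def)
  qed
qed

lemma X_tendsto: "AE \<omega> in M. ((\<lambda>t. X t \<omega>) \<longlongrightarrow> X_infty \<omega>) at_top"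
proof -
  obtain C where C: "\<And>S t. bounded_stopping S t \<Longrightarrow> (\<integral>\<^sup>+\<omega>. ennreal (X (S \<omega>) \<omega>) \<partial>M) \<le> ennreal C"
    by (rule moment_bound) blast
  have "AE \<omega> in M. \<exists>c. \<exists>\<^sub>F n in sequentially. X (real n) \<omega> \<le> c"
    by (rule AE_frequently_bounded[OF X_measurable C[OF bounded_stopping_const[OF _ order_refl]]]) auto
  \<comment> \<open>Quantifying over the countable type \<open>rat\<close> allows the null sets to
    be united.\<close>
  moreover have "AE \<omega> in M. \<forall>a b :: rat. a < b \<longrightarrow>
      \<not> ((\<exists>\<^sub>F t in at_top. real_of_rat b < X t \<omega>) \<and> (\<exists>\<^sub>F t in at_top. X t \<omega> < real_of_rat a))"
  proof -
    have "AE \<omega> in M. a < b \<longrightarrow>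
      \<not> ((\<exists>\<^sub>F t in at_top. real_of_rat b < X t \<omega>) \<and> (\<exists>\<^sub>F t in at_top. X t \<omega> < real_of_rat a))" for a b :: rat
      using oscillation_null[of "real_of_rat a" "real_of_rat b"]
      by (cases "a < b") (auto simp: of_rat_less)
    then show ?thesis unfolding AE_all_countable by blast
  qed
  ultimately show ?thesis
    using X_nonneg
  proof eventually_elim
    case (elim \<omega>)
    then obtain c where "\<exists>\<^sub>F n in sequentially. X (real n) \<omega> \<le> c" by blast
    then obtain L where L: "((\<lambda>t. X t \<omega>) \<longlongrightarrow> L) at_top"
      using no_oscillation_converges[of "\<lambda>t. X t \<omega>" c] elim by blast
    moreover have "X_infty \<omega> = L"
      unfolding X_infty_def terminal_value_def using L by (intro tendsto_Lim) auto
    ultimately show ?case by simp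
  qed
qed

end

section \<open>Survival functions\<close>

lemma continuous_on_mesh:
  fixes G :: "real \<Rightarrow> real"
  assumes "continuous_on {0..x} G" "0 \<le> x" "0 < e"
  obtains n :: nat where "0 < n"
    "\<And>i. i < n \<Longrightarrow> \<bar>G (x * real (Suc i) / real n) - G (x * real i / real n)\<bar> < e"
proof -
  have "uniformly_continuous_on {0..x} G"
    using assms(1) by (intro compact_uniformly_continuous) auto
  then obtain d where d: "0 < d"
    "\<And>s t. \<lbrakk>s \<in> {0..x}; t \<in> {0..x}; dist t s < d\<rbrakk> \<Longrightarrow> dist (G t) (G s) < e"
    unfolding uniformly_continuous_on_def using \<open>0 < e\<close> by metis
  obtain n :: nat where n: "x / d < real n" "0 < n"
    by (metis reals_Archimedean2 gr0I of_nat_0 assms(2) d(1) divide_nonneg_pos not_le)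
  have "\<bar>G (x * real (Suc i) / real n) - G (x * real i / real n)\<bar> < e" if "i < n" for i
  proof -
    have mem: "x * real j / real n \<in> {0..x}" if "j \<le> n" for j
      using assms(2) n(2) that by (auto simp: divide_le_eq intro: mult_left_mono)
    have "x * real (Suc i) / real n - x * real i / real n = x / real n"
      by (simp add: add_divide_distrib algebra_simps)
    moreover have "0 \<le> x / real n" "x / real n < d"
      using n d(1) assms(2) by (auto simp: field_simps)
    ultimately have "dist (x * real (Suc i) / real n) (x * real i / real n) < d"
      by (simp add: dist_real_def)
    with d(2)[OF mem[of i] mem[of "Suc i"]] that show ?thesis
      by (simp only: dist_real_def)
  qed
  with n(2) show thesis by (rule that)
qed

text \<open>Formally G' = - G k, but \<open>k\<close> is only measurable, so pointwise derivatives
  are avoided: with K the primitive of \<open>k\<close>, the function \<open>ln G + K\<close> is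
  shown to vanish at x by summing its increments. The lower bound c = \<open>G x\<close> > 0 gives
  integrability of \<open>k\<close> from that of \<open>G z * k z\<close> and keeps logarithms and
  quotients under control.\<close>

lemma exp_integral_of_decay:
  fixes G k :: "real \<Rightarrow> real"
  assumes "0 \<le> x" and G_pos: "0 < G x"
    and G_anti: "\<And>s t. \<lbrakk>0 \<le> s; s \<le> t; t \<le> x\<rbrakk> \<Longrightarrow> G t \<le> G s"
    and k_meas [measurable]: "k \<in> borel_measurable borel" and k_pos: "\<And>z. 0 \<le> k z"
    and int: "set_integrable lborel {0..x} (\<lambda>z. G z * k z)"
    and eq: "\<And>y. \<lbrakk>0 \<le> y; y \<le> x\<rbrakk> \<Longrightarrow> 1 - G y = (LBINT z:{0..y}. G z * k z)"
  shows "set_integrable lborel {0..x} k" "G x = exp (- (LBINT z:{0..x}. k z))"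
proof -
  define c where "c = G x"
  have c: "0 < c" "\<And>y. 0 \<le> y \<Longrightarrow> y \<le> x \<Longrightarrow> c \<le> G y"
    using G_pos G_anti unfolding c_def by auto
  show k_int: "set_integrable lborel {0..x} k"
  proof (rule set_integrable_bound)
    show "set_integrable lborel {0..x} (\<lambda>z. (1 / c) * (G z * k z))"
      using int by (rule set_integrable_mult_right)
    show "set_borel_measurable lborel {0..x} k" unfolding set_borel_measurable_def by measurable
    show "AE z in lborel. z \<in> {0..x} \<longrightarrow> norm (k z) \<le> norm (1 / c * (G z * k z))"
    proof (intro AE_I2 impI)
      fix z assume "z \<in> {0..x}"
      then have "c * k z \<le> G z * k z" using c k_pos by (intro mult_right_mono) auto
      moreover have "0 \<le> c * k z" using c(1) k_pos[of z] by simp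
      ultimately show "norm (k z) \<le> norm (1 / c * (G z * k z))"
        using c(1) k_pos[of z] by (simp add: field_simps)
    qed
  qed
  have k_hk: "k integrable_on {s..t}" if "0 \<le> s" "t \<le> x" for s t
    using set_borel_integral_eq_integral(1)[OF set_integrable_subset[OF k_int, of "{s..t}"]] that
    by auto
  have Gk_hk: "(\<lambda>z. G z * k z) integrable_on {s..t}" if "0 \<le> s" "t \<le> x" for s t
    using set_borel_integral_eq_integral(1)[OF set_integrable_subset[OF int, of "{s..t}"]] that
    by auto
  have G_eq: "G y = 1 - integral {0..y} (\<lambda>z. G z * k z)" if "0 \<le> y" "y \<le> x" for y
    using set_borel_integral_eq_integral(2)[OF set_integrable_subset[OF int, of "{0..y}"]] that
      eq[OF that] by auto
  define K where "K y = integral {0..y} k" for y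
  have K_diff: "K t - K s = integral {s..t} k" if "0 \<le> s" "s \<le> t" "t \<le> x" for s t
    using Henstock_Kurzweil_Integration.integral_combine[OF that(1,2) k_hk[of 0 t]] that
    unfolding K_def by simp
  have G_diff: "G s - G t = integral {s..t} (\<lambda>z. G z * k z)" if "0 \<le> s" "s \<le> t" "t \<le> x" for s t
    using Henstock_Kurzweil_Integration.integral_combine[OF that(1,2) Gk_hk[of 0 t]] that
      G_eq[of s] G_eq[of t] by simp
  \<comment> \<open>The increments of \<open>ln G + K\<close> are of second order in those of \<open>G\<close>, so they sum to 0 over fine meshes.\<close>
  have incr: "\<bar>(ln (G t) + K t) - (ln (G s) + K s)\<bar> \<le> (G s - G t)\<^sup>2 / c\<^sup>2"
    if st: "0 \<le> s" "s \<le> t" "t \<le> x" for s t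
  proof -
    have pos: "0 < G s" "0 < G t" "c \<le> G s" "c \<le> G t" "G t \<le> G s"
      using c G_anti st by (auto intro: less_le_trans)
    have 1: "G t * integral {s..t} k \<le> integral {s..t} (\<lambda>z. G z * k z)"
      using k_pos G_anti st
      by (subst Henstock_Kurzweil_Integration.integral_mult_right[symmetric],
          intro integral_le Gk_hk integrable_on_mult_right k_hk)
        (auto intro!: mult_right_mono)
    have 2: "integral {s..t} (\<lambda>z. G z * k z) \<le> G s * integral {s..t} k"
      using k_pos G_anti st
      by (subst Henstock_Kurzweil_Integration.integral_mult_right[symmetric],
          intro integral_le Gk_hk integrable_on_mult_right k_hk)
        (auto intro!: mult_right_mono)
    have K: "(G s - G t) / G s \<le> K t - K s" "K t - K s \<le> (G s - G t) / G t"
      using 1 2 pos K_diff[OF st] G_diff[OF st] by (auto simp: field_simps)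
    have "ln (G s / G t) \<le> G s / G t - 1" using pos by (intro ln_le_minus_one) auto
    moreover have "ln (G t / G s) \<le> G t / G s - 1" using pos by (intro ln_le_minus_one) auto
    ultimately have L: "ln (G s) - ln (G t) \<le> (G s - G t) / G t" "(G s - G t) / G s \<le> ln (G s) - ln (G t)"
      using pos by (auto simp: ln_div field_simps)
    \<comment> \<open>The increment of K and the decrement of \<open>ln G\<close> lie between the
      same two bounds, so they differ by at most the gap between these.\<close>
    have "\<bar>(ln (G t) + K t) - (ln (G s) + K s)\<bar> \<le> (G s - G t) / G t - (G s - G t) / G s"
      using K L by linarith
    also have "\<dots> = (G s - G t)\<^sup>2 / (G s * G t)"
      using pos by (simp add: field_simps power2_eq_square)
    also have "\<dots> \<le> (G s - G t)\<^sup>2 / c\<^sup>2"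
      using pos c(1) by (intro divide_left_mono) (auto simp: power2_eq_square intro: mult_mono)
    finally show ?thesis .
  qed
  \<comment> \<open>Continuity of \<open>G\<close> is not assumed; it comes from the integral
    equation.\<close>
  have "continuous_on {0..x} (\<lambda>y. 1 - integral {0..y} (\<lambda>z. G z * k z))"
    by (intro continuous_intros indefinite_integral_continuous_1 Gk_hk) auto
  then have cont: "continuous_on {0..x} G"
    by (rule continuous_on_eq) (use G_eq in auto)
  have zero: "ln (G 0) + K 0 = 0"
    using G_eq[of 0] assms(1) unfolding K_def by simp
  have bound: "\<bar>ln (G x) + K x\<bar> \<le> e * ((1 - c) / c\<^sup>2)" if "0 < e" for e
  proof -
    obtain n :: nat where n: "0 < n"
      "\<And>i. i < n \<Longrightarrow> \<bar>G (x * real (Suc i) / real n) - G (x * real i / real n)\<bar> < e"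
      using continuous_on_mesh[OF cont assms(1) \<open>0 < e\<close>] by metis
    define p where "p i = x * real i / real n" for i
    define \<phi> where "\<phi> y = ln (G y) + K y" for y
    have p: "0 \<le> p i" "p i \<le> p (Suc i)" "p (Suc i) \<le> x" if "i < n" for i
    proof -
      show "0 \<le> p i" "p i \<le> p (Suc i)" unfolding p_def using n(1) assms(1)
        by (auto intro!: divide_right_mono mult_left_mono)
      have "x * real (Suc i) \<le> x * real n" using that assms(1) by (intro mult_left_mono) auto
      then show "p (Suc i) \<le> x" unfolding p_def using n(1) by (simp add: divide_le_eq)
    qed
    have p0: "p 0 = 0" "p n = x" using n(1) by (auto simp: p_def)
    have "\<phi> x - \<phi> 0 = (\<Sum>i<n. \<phi> (p (Suc i)) - \<phi> (p i))"
      using sum_lessThan_telescope[of "\<lambda>i. \<phi> (p i)" n] p0 by simp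
    then have "\<bar>\<phi> x\<bar> \<le> (\<Sum>i<n. \<bar>\<phi> (p (Suc i)) - \<phi> (p i)\<bar>)"
      using zero unfolding \<phi>_def by simp
    \<comment> \<open>One factor of each squared increment is bounded by the mesh oscillation e, the
      other telescopes.\<close>
    also have "\<dots> \<le> (\<Sum>i<n. e / c\<^sup>2 * (G (p i) - G (p (Suc i))))"
    proof (rule sum_mono)
      fix i assume "i \<in> {..<n}"
      then have i: "i < n" by simp
      have d: "0 \<le> G (p i) - G (p (Suc i))" "G (p i) - G (p (Suc i)) \<le> e"
        using G_anti[OF p[OF i]] n(2)[OF i] unfolding p_def by auto
      have "\<bar>\<phi> (p (Suc i)) - \<phi> (p i)\<bar> \<le> (G (p i) - G (p (Suc i)))\<^sup>2 / c\<^sup>2"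
        using incr[OF p[OF i]] unfolding \<phi>_def .
      also have "\<dots> \<le> e * (G (p i) - G (p (Suc i))) / c\<^sup>2"
        unfolding power2_eq_square[of "G (p i) - G (p (Suc i))"]
        using d by (intro divide_right_mono mult_right_mono) auto
      finally show "\<bar>\<phi> (p (Suc i)) - \<phi> (p i)\<bar> \<le> e / c\<^sup>2 * (G (p i) - G (p (Suc i)))"
        by simp
    qed
    also have "\<dots> = e / c\<^sup>2 * (G 0 - G x)"
      unfolding sum_distrib_left[symmetric] sum_lessThan_telescope'[of "\<lambda>i. G (p i)"]
      by (simp only: p0)
    also have "G 0 = 1" using G_eq[of 0] assms(1) by simp
    finally show ?thesis unfolding \<phi>_def c_def by simp
  qed
  have "\<bar>ln (G x) + K x\<bar> \<le> 0"
  proof (rule tendsto_le[OF _ _ tendsto_const])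
    show "((\<lambda>e. e * ((1 - c) / c\<^sup>2)) \<longlongrightarrow> 0) (at_right 0)"
      by (rule tendsto_eq_intros tendsto_ident_at refl | simp)+
    show "\<forall>\<^sub>F e in at_right 0. \<bar>ln (G x) + K x\<bar> \<le> e * ((1 - c) / c\<^sup>2)"
      using bound by (auto simp: eventually_at_right_less intro: eventually_at_right_less[THEN eventually_mono])
  qed auto
  then have "ln (G x) = - K x" by simp
  moreover have "K x = (LBINT z:{0..x}. k z)"
    unfolding K_def by (rule set_borel_integral_eq_integral(2)[symmetric, OF k_int])
  ultimately show "G x = exp (- (LBINT z:{0..x}. k z))" using G_pos by (metis exp_ln)
qed

section \<open>From the tail identity for a law to its survival function\<close>

context real_distribution
begin

text \<open>For z \<ge> 0, \<open>min z y\<close> is the Lebesgue measure of the points u of [0, y]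
  with u < z; exchanging the integrals turns it into tail probabilities.\<close>

lemma layer_cake_min:
  assumes "AE z in M. 0 \<le> z" "0 \<le> y"
  shows "(\<integral>\<^sup>+z. ennreal (min z y) \<partial>M) = (\<integral>\<^sup>+u. ennreal (measure M {u<..}) * indicator {0..y} u \<partial>lborel)"
proof -
  interpret pair_sigma_finite M lborel by standard
  have "(\<integral>\<^sup>+z. ennreal (min z y) \<partial>M) = (\<integral>\<^sup>+z. (\<integral>\<^sup>+u. indicator {0..y} u * indicator {u<..} z \<partial>lborel) \<partial>M)"
  proof (rule nn_integral_cong_AE, use assms(1) in eventually_elim)
    fix z :: real assume "0 \<le> z"
    have "(\<integral>\<^sup>+u. indicator {0..y} u * indicator {u<..} z \<partial>lborel) =
      (\<integral>\<^sup>+u. indicator ({0..y} \<inter> {..<z}) u \<partial>lborel)"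
      by (intro nn_integral_cong) (auto split: split_indicator)
    also have "\<dots> = emeasure lborel ({0..y} \<inter> {..<z})" by simp
    also have "{0..y} \<inter> {..<z} = (if y < z then {0..y} else {0..<z})" by auto
    also have "emeasure lborel \<dots> = ennreal (min z y)"
      using \<open>0 \<le> z\<close> assms(2) by (auto simp: min_def)
    finally show "ennreal (min z y) = (\<integral>\<^sup>+u. indicator {0..y} u * indicator {u<..} z \<partial>lborel)" ..
  qed
  also have "\<dots> = (\<integral>\<^sup>+u. (\<integral>\<^sup>+z. indicator {0..y} u * indicator {u<..} z \<partial>M) \<partial>lborel)"
  proof (rule Fubini'[symmetric])
    have "(\<lambda>(z::real, u). indicator {0..y} u * indicator {u<..} z :: ennreal) =
      (\<lambda>p. indicator {0..y} (snd p) * indicator {p. snd p < fst p} p)"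
      by (auto split: split_indicator)
    also have "\<dots> \<in> borel_measurable (M \<Otimes>\<^sub>M lborel)"
    proof -
      have [measurable]: "{p. snd p < fst p} \<in> sets (M \<Otimes>\<^sub>M (lborel :: real measure))"
      proof -
        have "sets (M \<Otimes>\<^sub>M (lborel :: real measure)) = sets (borel :: (real \<times> real) measure)"
          unfolding borel_prod[symmetric] by (rule sets_pair_measure_cong) auto
        moreover have "{p. snd p < fst p} \<in> sets (borel :: (real \<times> real) measure)"
          by (intro borel_open open_Collect_less continuous_intros)
        ultimately show ?thesis by simp
      qed
      show ?thesis by measurable
    qed
    finally show "(\<lambda>(z, u). indicator {0..y} u * indicator {u<..} z :: ennreal) \<in> borel_measurable (M \<Otimes>\<^sub>M lborel)" .
  qed
  also have "\<dots> = (\<integral>\<^sup>+u. ennreal (measure M {u<..}) * indicator {0..y} u \<partial>lborel)"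
  proof (rule nn_integral_cong)
    fix u :: real
    have "(\<integral>\<^sup>+z. indicator {0..y} u * indicator {u<..} z \<partial>M) =
      indicator {0..y} u * (\<integral>\<^sup>+z. indicator {u<..} z \<partial>M)"
      by (rule nn_integral_cmult) simp
    also have "\<dots> = ennreal (measure M {u<..}) * indicator {0..y} u"
      by (simp add: emeasure_eq_measure mult.commute)
    finally show "(\<integral>\<^sup>+z. indicator {0..y} u * indicator {u<..} z \<partial>M) =
      ennreal (measure M {u<..}) * indicator {0..y} u" .
  qed
  finally show ?thesis .
qed

text \<open>Together with \<open>layer_cake_min\<close>, the hypothesis \<open>l_int\<close> says
  that the measures with density \<open>l\<close> against the law and density \<open>G\<close>
  against Lebesgue measure have the same distribution function up to x, hence are equal. Integrating
  suitable functions against both then gives positivity of \<open>l\<close> Lebesgue almost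
  everywhere and the integral equation for \<open>G\<close>.\<close>

lemma survival_eq_exp:
  fixes l :: "real \<Rightarrow> real"
  assumes [measurable]: "l \<in> borel_measurable borel"
    and pos: "AE z in M. 0 \<le> z" "AE z in M. 0 < l z"
    and l_int: "\<And>y. 0 \<le> y \<Longrightarrow>
      (\<integral>\<^sup>+z. ennreal (l z) * indicator {..y} z \<partial>M) = (\<integral>\<^sup>+z. ennreal (min z y) \<partial>M)"
    and x: "0 \<le> x" "0 < measure M {x<..}"
  shows "set_integrable lborel {0..x} (\<lambda>z. 1 / l z) \<and>
    measure M {x<..} = exp (- (LBINT z:{0..x}. 1 / l z))"
proof -
  define G where "G u = measure M {u<..}" for u
  have G_anti: "G t \<le> G s" if "s \<le> t" for s t
    unfolding G_def using that by (intro finite_measure_mono) auto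
  have "mono (\<lambda>u. - G u)" using G_anti by (auto simp: mono_def)
  then have "(\<lambda>u. - G u) \<in> borel_measurable borel" by (rule borel_measurable_mono)
  then have G_meas [measurable]: "G \<in> borel_measurable borel" by simp
  \<comment> \<open>Cutting off at x leaves both measures with mass at most x, and finite measures
    are determined by their distribution functions.\<close>
  define \<nu> where "\<nu> = density M (\<lambda>z. ennreal (l z) * indicator {..x} z)"
  define \<nu>' where "\<nu>' = density lborel (\<lambda>u. ennreal (G u) * indicator {0..x} u)"
  have em: "emeasure \<nu> {..y} = emeasure \<nu>' {..y} \<and> emeasure \<nu> {..y} \<le> ennreal x" for y
  proof (cases "0 \<le> y")
    case True
    have "emeasure \<nu> {..y} = (\<integral>\<^sup>+z. ennreal (l z) * indicator {..min x y} z \<partial>M)"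
      unfolding \<nu>_def by (subst emeasure_density) (auto intro!: nn_integral_cong split: split_indicator)
    also have "\<dots> = (\<integral>\<^sup>+z. ennreal (min z (min x y)) \<partial>M)" using l_int[of "min x y"] x(1) True by simp
    finally have 1: "emeasure \<nu> {..y} = (\<integral>\<^sup>+z. ennreal (min z (min x y)) \<partial>M)" .
    also have "\<dots> = (\<integral>\<^sup>+u. ennreal (G u) * indicator {0..min x y} u \<partial>lborel)"
      unfolding G_def using x(1) True by (intro layer_cake_min pos) auto
    also have "\<dots> = emeasure \<nu>' {..y}"
      unfolding \<nu>'_def by (subst emeasure_density) (auto intro!: nn_integral_cong split: split_indicator)
    finally have 2: "emeasure \<nu> {..y} = emeasure \<nu>' {..y}" .
    have "(\<integral>\<^sup>+z. ennreal (min z (min x y)) \<partial>M) \<le> (\<integral>\<^sup>+z. ennreal x \<partial>M)"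
      by (intro nn_integral_mono ennreal_leI) auto
    also have "\<dots> = ennreal x" using emeasure_space_1 by simp
    finally show ?thesis using 1 2 by simp
  next
    case False
    have "emeasure \<nu> {..y} = (\<integral>\<^sup>+z. 0 \<partial>M)"
      unfolding \<nu>_def
      by (subst emeasure_density, simp, simp, rule nn_integral_cong_AE, use pos(1) in eventually_elim)
        (use False in \<open>auto split: split_indicator\<close>)
    moreover have "emeasure \<nu>' {..y} = (\<integral>\<^sup>+z. ennreal (G z) * indicator {0..x} z * indicator {..y} z \<partial>lborel)"
      unfolding \<nu>'_def by (rule emeasure_density) auto
    moreover have "(\<lambda>z. ennreal (G z) * indicator {0..x} z * indicator {..y} z) = (\<lambda>z. 0)"
      using False by (auto split: split_indicator)
    ultimately show ?thesis by simp
  qed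
  have sets: "sets \<nu> = sets borel" "sets \<nu>' = sets borel" unfolding \<nu>_def \<nu>'_def by auto
  then have space: "space \<nu> = UNIV" "space \<nu>' = UNIV"
    by (auto dest: sets_eq_imp_space_eq)
  have "emeasure \<nu> UNIV = emeasure \<nu> {..x}" "emeasure \<nu>' UNIV = emeasure \<nu>' {..x}"
    unfolding \<nu>_def \<nu>'_def
    by (subst (1 2) emeasure_density; auto intro!: nn_integral_cong split: split_indicator)+
  then have "emeasure \<nu> UNIV \<noteq> \<infinity>" "emeasure \<nu>' UNIV \<noteq> \<infinity>"
    using em[of x] by (auto simp: top_unique)
  then have "finite_borel_measure \<nu>" "finite_borel_measure \<nu>'"
    unfolding finite_borel_measure_def finite_borel_measure_axioms_def
    using sets space by (auto intro!: finite_measureI)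
  moreover have "cdf \<nu> = cdf \<nu>'"
    using em by (auto simp: cdf_def2 measure_def)
  ultimately have "\<nu> = \<nu>'" by (rule cdf_unique')
  then have change: "(\<integral>\<^sup>+z. ennreal (l z) * indicator {..x} z * g z \<partial>M) =
      (\<integral>\<^sup>+u. ennreal (G u) * indicator {0..x} u * g u \<partial>lborel)"
    if [measurable]: "g \<in> borel_measurable borel" for g
    using nn_integral_density[of "\<lambda>z. ennreal (l z) * indicator {..x} z" M g]
      nn_integral_density[of "\<lambda>u. ennreal (G u) * indicator {0..x} u" lborel g]
    unfolding \<nu>_def \<nu>'_def by simp
  \<comment> \<open>Positivity of \<open>l\<close> is given only almost everywhere for the law. The
    set where \<open>l\<close> is not positive is null for the common measure, and on [0, x] that
    measure has the Lebesgue density \<open>G\<close>, which is at least \<open>G x\<close> >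
    0.\<close>
  have l_pos: "AE z in lborel. z \<in> {0..x} \<longrightarrow> 0 < l z"
  proof -
    have "(\<integral>\<^sup>+u. ennreal (G u) * indicator {0..x} u * indicator {z. l z \<le> 0} u \<partial>lborel) = 
        (\<integral>\<^sup>+z. ennreal (l z) * indicator {..x} z * indicator {z. l z \<le> 0} z \<partial>M)"
      by (rule change[symmetric]) measurable
    also have "\<dots> = (\<integral>\<^sup>+z. 0 \<partial>M)"
      by (rule nn_integral_cong_AE) (use pos(2) in \<open>eventually_elim, auto split: split_indicator\<close>)
    finally have "AE u in lborel. ennreal (G u) * indicator {0..x} u * indicator {z. l z \<le> 0} u = 0"
      by (subst nn_integral_0_iff_AE[symmetric]) auto
    then show ?thesis
    proof eventually_elim
      case (elim u)
      have "0 < G u" if "u \<in> {0..x}" using G_anti[of u x] x(2) that unfolding G_def by auto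
      with elim show ?case by (auto split: split_indicator_asm)
    qed
  qed
  \<comment> \<open>A nonnegative version of 1 / l, defined without exceptions; it agrees with 1 / l
    Lebesgue almost everywhere on [0, x].\<close>
  define k where "k z = (if 0 < l z then 1 / l z else 0)" for z
  have k_meas [measurable]: "k \<in> borel_measurable borel" unfolding k_def by measurable
  have k_pos: "0 \<le> k z" for z unfolding k_def by simp
  \<comment> \<open>The test function is \<open>k\<close> cut off at y: almost everywhere for the
    law, \<open>l\<close> times \<open>k\<close> is 1, so what remains is the mass of {..y}.\<close>
  have Gk: "(\<integral>\<^sup>+z. ennreal (indicator {0..y} z * (G z * k z)) \<partial>lborel) = ennreal (1 - G y)"
    if y: "0 \<le> y" "y \<le> x" for y
  proof -
    have "(\<integral>\<^sup>+z. ennreal (indicator {0..y} z * (G z * k z)) \<partial>lborel) = 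
      (\<integral>\<^sup>+u. ennreal (G u) * indicator {0..x} u * (indicator {..y} u * ennreal (k u)) \<partial>lborel)"
      using y by (intro nn_integral_cong)
        (auto split: split_indicator simp: ennreal_mult k_pos G_def)
    also have "\<dots> = (\<integral>\<^sup>+z. ennreal (l z) * indicator {..x} z * (indicator {..y} z * ennreal (k z)) \<partial>M)"
      by (rule change[symmetric]) measurable
    also have "\<dots> = (\<integral>\<^sup>+z. indicator {..y} z \<partial>M)"
      by (rule nn_integral_cong_AE, use pos(2) in eventually_elim)
        (use y in \<open>auto split: split_indicator simp: k_def ennreal_mult[symmetric]\<close>)
    also have "\<dots> = ennreal (measure M {..y})" by (simp add: emeasure_eq_measure)
    also have "measure M {..y} = 1 - G y"
      unfolding G_def using prob_compl[of "{y<..}"] by (simp add: Compl_eq_Diff_UNIV[symmetric] not_less[symmetric])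
    finally show ?thesis .
  qed
  have G_le1: "G y \<le> 1" for y unfolding G_def by simp
  have int: "integrable lborel (\<lambda>z. indicator {0..y} z * (G z * k z))"
    and eq: "1 - G y = (\<integral>z. indicator {0..y} z * (G z * k z) \<partial>lborel)" if y: "0 \<le> y" "y \<le> x" for y
  proof -
    have nn: "0 \<le> indicator {0..y} z * (G z * k z)" for z
      using k_pos by (auto simp: G_def)
    show "integrable lborel (\<lambda>z. indicator {0..y} z * (G z * k z))"
      by (rule integrableI_nonneg) (use nn Gk[OF y] in \<open>auto\<close>)
    show "1 - G y = (\<integral>z. indicator {0..y} z * (G z * k z) \<partial>lborel)"
      by (subst integral_eq_nn_integral) (use nn Gk[OF y] G_le1[of y] in auto)
  qed
  have "set_integrable lborel {0..x} k" "G x = exp (- (LBINT z:{0..x}. k z))"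
    by (rule exp_integral_of_decay[of x G k];
        use int eq G_anti x k_pos in \<open>simp add: G_def[symmetric] set_integrable_def set_lebesgue_integral_def\<close>)+
  moreover have "set_integrable lborel {0..x} k \<longleftrightarrow> set_integrable lborel {0..x} (\<lambda>z. 1 / l z)"
    by (rule set_integrable_cong_AE) (use l_pos in \<open>auto simp: k_def\<close>)
  moreover have "(LBINT z:{0..x}. k z) = (LBINT z:{0..x}. 1 / l z)"
    by (rule set_lebesgue_integral_cong_AE) (use l_pos in \<open>auto simp: k_def\<close>)
  ultimately show ?thesis unfolding G_def by simp
qed

end

section \<open>Stopping at a level\<close>

context sigma_D_process
begin

text \<open>The level must be exceeded strictly: the target set is then open, as the measurability
  of entrance times demands, and \<open>A\<close> grows immediately after an entrance before the
  cap.\<close>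

definition level_time :: "real \<Rightarrow> real \<Rightarrow> 'a \<Rightarrow> real" where
  "level_time x = hit A {x<..} (space M) 0"

lemma level_time_stopping: "0 \<le> t \<Longrightarrow> bounded_stopping (level_time x t) t"
  unfolding level_time_def
  using sets.top[of "F 0"] space_F[of 0]
  by (intro hit_stopping[OF adapted_A A_right_continuous]) auto

text \<open>Composition with \<open>max 0\<close> extends the path to a monotone continuous function
  on the whole line, as the formula for \<open>interval_measure\<close> on half-open intervals
  requires.\<close>

lemma path_measure_Ioc:
  assumes cont: "continuous_on {0..} (\<lambda>t. A t \<omega>)" and mono: "mono_on {0..} (\<lambda>t. A t \<omega>)"
    and h: "0 \<le> h" "h \<le> u"
  shows "emeasure (path_measure A \<omega>) {h<..u} = ennreal (A u \<omega> - A h \<omega>)"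
proof -
  have "continuous_on UNIV (\<lambda>t::real. max 0 t)" by (intro continuous_intros)
  then have "continuous_on UNIV ((\<lambda>t. A t \<omega>) \<circ> (\<lambda>t. max 0 t))"
    by (rule continuous_on_compose) (rule continuous_on_subset[OF cont], auto)
  then have "continuous_on UNIV (\<lambda>t. A (max 0 t) \<omega>)" by (simp add: comp_def)
  then have right: "continuous (at_right a) (\<lambda>t. A (max 0 t) \<omega>)" for a
    by (simp add: continuous_on_eq_continuous_at continuous_at_imp_continuous_within)
  have "A (max 0 s) \<omega> \<le> A (max 0 t) \<omega>" if "s \<le> t" for s t
    by (rule mono_onD[OF mono]) (use that in auto)
  from emeasure_interval_measure_Ioc[OF h(2) this right]
  have "emeasure (interval_measure (\<lambda>t. A (max 0 t) \<omega>)) {h<..u} =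
      ennreal (A (max 0 u) \<omega> - A (max 0 h) \<omega>)" .
  then show ?thesis using h by (simp add: path_measure_def)
qed

text \<open>When the level is exceeded before the cap, \<open>A\<close> at that time is at least x
  by closure and at most x because an exceedance would have begun earlier. Growth of
  \<open>A\<close> just afterwards charges every right neighbourhood, which therefore contains a
  zero of \<open>X\<close>. One null set serves all t.\<close>

lemma level_time_values:
  assumes "0 \<le> x"
  shows "AE \<omega> in M. \<forall>t\<ge>0. A (level_time x t \<omega>) \<omega> = min (A t \<omega>) x \<and>
    X (level_time x t \<omega>) \<omega> = (if A t \<omega> \<le> x then X t \<omega> else 0)"
  using A_path X_right_continuous A_right_continuous A_carried AE_space
proof eventually_elim
  case (elim \<omega>)
  then have cont: "continuous_on {0..} (\<lambda>t. A t \<omega>)" and mono: "mono_on {0..} (\<lambda>t. A t \<omega>)"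
    and A0: "A 0 \<omega> = 0" by auto
  have A_le: "A s \<omega> \<le> A t \<omega>" if "0 \<le> s" "s \<le> t" for s t
    by (rule mono_onD[OF mono]) (use that in auto)
  \<comment> \<open>A value strictly between x and \<open>A t\<close>, here the midpoint, is
    attained by continuity, and necessarily before t. Its use of the intermediate value theorem
    rests on \<open>A 0\<close> = 0 \<le> x.\<close>
  have earlier: "\<exists>s. 0 \<le> s \<and> s < t \<and> x < A s \<omega>" if t: "0 \<le> t" "x < A t \<omega>" for t
  proof -
    have "continuous_on {0..t} (\<lambda>t. A t \<omega>)" by (rule continuous_on_subset[OF cont]) auto
    then obtain s where "0 \<le> s" "s \<le> t" "A s \<omega> = (x + A t \<omega>) / 2"
      using IVT'[of "\<lambda>t. A t \<omega>" 0 "(x + A t \<omega>) / 2" t] t assms A0 by auto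
    then show ?thesis using t(2) by (intro exI[of _ s]) (cases "s = t", auto)
  qed
  show ?case
  proof (intro allI impI)
    fix t :: real assume t: "0 \<le> t"
    define h where "h = level_time x t \<omega>"
    have h: "0 \<le> h" "h \<le> t" using hit_bounds[OF t] by (auto simp: h_def level_time_def)
    have less: "h < u \<longleftrightarrow> (\<exists>s. 0 \<le> s \<and> s < u \<and> x < A s \<omega>)" if "u \<le> t" for u
      unfolding h_def level_time_def using elim(5) by (simp add: hit_less_iff[OF t that])
    show "A (level_time x t \<omega>) \<omega> = min (A t \<omega>) x \<and>
      X (level_time x t \<omega>) \<omega> = (if A t \<omega> \<le> x then X t \<omega> else 0)"
    proof (cases "A t \<omega> \<le> x")
      case True
      have "\<not> h < t"
      proof
        assume "h < t"
        then obtain s where "0 \<le> s" "s < t" "x < A s \<omega>" using less[of t] by auto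
        then show False using A_le[of s t] True by auto
      qed
      then show ?thesis using h True by (simp add: h_def[symmetric])
    next
      case False
      then have ht: "h < t" using less[of t] earlier[OF t] by auto
      have "A h \<omega> \<in> closure {x<..}"
        using ht elim(3) unfolding h_def level_time_def
        by (intro hit_closure[where Z = A, OF order_refl t]) auto
      then have "x \<le> A h \<omega>" by simp
      moreover have "\<not> x < A h \<omega>" using earlier[OF h(1)] less[OF h(2)] by auto
      ultimately have Ah: "A h \<omega> = x" by simp
      have zero: "\<exists>r. h < r \<and> r < u \<and> X r \<omega> = 0" if u: "h < u" for u
      proof (rule ccontr)
        \<comment> \<open>The midpoint keeps \<open>v\<close> below \<open>u\<close>, and the cap at
          \<open>t\<close> allows \<open>less\<close> to be applied to \<open>v\<close>. Without
          zeros of \<open>X\<close> in (h, v] this interval would carry no mass, so \<open>A\<close>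
          could not exceed x before \<open>v\<close>.\<close>
        define v where "v = min t ((h + u) / 2)"
        have v: "h < v" "v < u" "v \<le> t" using u ht by (auto simp: v_def min_def field_simps)
        assume none: "\<not> ?thesis"
        have "AE r in path_measure A \<omega>. \<not> (h < r \<and> r \<le> v)"
          using elim(4)
        proof eventually_elim
          case (elim r)
          then show ?case using none v by auto
        qed
        then have "emeasure (path_measure A \<omega>) {r \<in> space (path_measure A \<omega>). h < r \<and> r \<le> v} = 0"
          by (rule emeasure_eq_0_AE)
        moreover have "{r \<in> space (path_measure A \<omega>). h < r \<and> r \<le> v} = {h<..v}"
          by (auto simp: path_measure_def)
        ultimately have "ennreal (A v \<omega> - A h \<omega>) = 0"
          using path_measure_Ioc[OF cont mono h(1), of v] v(1) by simp
        then have "A v \<omega> \<le> x" using Ah by (simp add: ennreal_eq_0_iff)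
        moreover obtain s where "0 \<le> s" "s < v" "x < A s \<omega>" using less[OF v(3)] v(1) by auto
        ultimately show False using A_le[of s v] by auto
      qed
      have "X h \<omega> = 0"
      proof (rule ccontr)
        assume "X h \<omega> \<noteq> 0"
        have "((\<lambda>s. X s \<omega>) \<longlongrightarrow> X h \<omega>) (at_right h)" using elim(2) h(1) by blast
        then have "\<forall>\<^sub>F r in at_right h. X r \<omega> \<noteq> 0"
          using \<open>X h \<omega> \<noteq> 0\<close> by (rule tendsto_imp_eventually_ne)
        then obtain u where "h < u" "\<And>r. \<lbrakk>h < r; r < u\<rbrakk> \<Longrightarrow> X r \<omega> \<noteq> 0"
          unfolding eventually_at_right_field by blast
        with zero show False by blast
      qed
      then show ?thesis using False Ah by (simp add: h_def[symmetric])
    qed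
  qed
qed

lemma X_tendsto_nat: "AE \<omega> in M. (\<lambda>n. X (real n) \<omega>) \<longlonglongrightarrow> X_infty \<omega>"
  using X_tendsto
proof eventually_elim
  case (elim \<omega>)
  then show ?case by (rule filterlim_compose) (rule filterlim_real_sequentially)
qed

lemma X_infty_measurable: "X_infty \<in> borel_measurable M"
  using borel_measurable_AE_limit[OF X_measurable X_tendsto_nat] by simp

lemma X_infty_integrable: "integrable M X_infty"
  by (rule uniformly_integrable_limit(1)[OF UI stopped_value[OF bounded_stopping_const[OF _ order_refl]]
        X_infty_measurable X_tendsto_nat]) simp

lemma X_infty_nonneg: "AE \<omega> in M. 0 \<le> X_infty \<omega>"
  using X_tendsto_nat X_nonneg
proof eventually_elim
  case (elim \<omega>)
  then show ?case by (intro LIMSEQ_le_const[OF elim(1)]) auto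
qed

text \<open>Balance at the level times, in the limit of growing caps: the values of \<open>A\<close>
  there are dominated by x, those of \<open>X\<close> are uniformly integrable.\<close>

proposition expectation_below_level:
  assumes x: "0 \<le> x"
  shows "(\<integral>\<omega>. indicator {\<omega>\<in>space M. A_infty \<omega> \<le> x} \<omega> * X_infty \<omega> \<partial>M) = (\<integral>\<omega>. min (A_infty \<omega>) x \<partial>M)"
proof -
  note [measurable] = A_infty_measurable X_infty_measurable
  define S where "S n = level_time x (real n)" for n
  have S: "bounded_stopping (S n) (real n)" for n
    unfolding S_def by (rule level_time_stopping) simp
  have vals: "AE \<omega> in M. \<forall>n. A (S n \<omega>) \<omega> = min (A (real n) \<omega>) x \<and>
      X (S n \<omega>) \<omega> = (if A (real n) \<omega> \<le> x then X (real n) \<omega> else 0)"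
    using level_time_values[OF x] by eventually_elim (simp add: S_def)
  have "(\<lambda>n. \<integral>\<omega>. A (S n \<omega>) \<omega> \<partial>M) \<longlonglongrightarrow> (\<integral>\<omega>. min (A_infty \<omega>) x \<partial>M)"
  proof (rule integral_dominated_convergence[where w = "\<lambda>_. x"])
    show "(\<lambda>\<omega>. A (S n \<omega>) \<omega>) \<in> borel_measurable M" for n
      using optional_balanced[OF S] by (auto simp: mean_balanced_def)
    show "AE \<omega> in M. (\<lambda>n. A (S n \<omega>) \<omega>) \<longlonglongrightarrow> min (A_infty \<omega>) x"
      using vals A_tendsto_nat
    proof eventually_elim
      case (elim \<omega>)
      then show ?case using tendsto_min[OF elim(2) tendsto_const[of x]] by simp
    qed
    show "AE \<omega> in M. norm (A (S n \<omega>) \<omega>) \<le> x" for n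
      using vals A_nonneg
    proof eventually_elim
      case (elim \<omega>)
      have "0 \<le> A (real n) \<omega>" using elim(2) by simp
      then show ?case using elim(1) x by (auto simp: min_def)
    qed
  qed auto
  moreover have "(\<lambda>n. \<integral>\<omega>. X (S n \<omega>) \<omega> \<partial>M) \<longlonglongrightarrow>
      (\<integral>\<omega>. indicator {\<omega>\<in>space M. A_infty \<omega> \<le> x} \<omega> * X_infty \<omega> \<partial>M)"
  proof (rule uniformly_integrable_limit(2)[OF UI stopped_value[OF S]])
    show "AE \<omega> in M. (\<lambda>n. X (S n \<omega>) \<omega>) \<longlonglongrightarrow> indicator {\<omega>\<in>space M. A_infty \<omega> \<le> x} \<omega> * X_infty \<omega>"
      using vals A_tendsto A_tendsto_nat X_tendsto_nat AE_space
    proof eventually_elim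
      case (elim \<omega>)
      show ?case
      proof (cases "A_infty \<omega> \<le> x")
        case True
        \<comment> \<open>The borderline case \<open>A_infty\<close> = x belongs here: the level is
          then reached at most in the limit or as a maximum and never exceeded, so the stopped value
          remains that of \<open>X\<close> at time n.\<close>
        have "A (real n) \<omega> \<le> x" for n
        proof -
          have "A (real n) \<omega> \<le> A_infty \<omega>" using elim(2) by simp
          with True show ?thesis by simp
        qed
        then show ?thesis using elim(1,4,5) True by simp
      next
        case False
        then have "\<forall>\<^sub>F n in sequentially. x < A (real n) \<omega>"
          using elim(3) by (intro order_tendstoD(1)) auto
        then have "\<forall>\<^sub>F n in sequentially. X (S n \<omega>) \<omega> = 0"
          by eventually_elim (use elim(1) in auto)
        then show ?thesis using False by (simp add: tendsto_eventually)
      qed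
    qed
  qed measurable
  moreover have "(\<integral>\<omega>. X (S n \<omega>) \<omega> \<partial>M) = (\<integral>\<omega>. A (S n \<omega>) \<omega> \<partial>M)" for n
    using optional_balanced[OF S] by (simp add: mean_balanced_def)
  ultimately show ?thesis using LIMSEQ_unique by fastforce
qed

end

text \<open>Integrability of 1 / l is asserted along with the formula, because the integral of a
  non-integrable function is 0 by default and the equation alone would not express the intended
  meaning.\<close>

theorem theorem4p1:
  fixes M :: "'a measure" and F :: "real \<Rightarrow> 'a measure"
    and X N A :: "real \<Rightarrow> 'a \<Rightarrow> real"
    and l :: "real \<Rightarrow> real" and x :: real
  assumes "usual_filtered_space M F"
    and "class_Sigma_D M F X N A"
    and "cond_exp_given_value M (terminal_value X) (terminal_value A) l"
    and "AE \<omega> in M. l (terminal_value A \<omega>) \<noteq> 0"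
    and "0 \<le> x" and "ereal x < upper_end M (terminal_value A)"
  shows "set_integrable lborel {0..x} (\<lambda>z. 1 / l z) \<and>
         measure M {\<omega> \<in> space M. x < terminal_value A \<omega>} =
           exp (- (LBINT z:{0..x}. 1 / l z))"
proof -
  interpret sigma_D_process M F X N A
    using assms(1,2) by unfold_locales
  have [measurable]: "A_infty \<in> borel_measurable M" "X_infty \<in> borel_measurable M"
    by (rule A_infty_measurable X_infty_measurable)+
  have l [measurable]: "l \<in> borel_measurable borel"
    using assms(3) unfolding cond_exp_given_value_def by blast
  define G where "G = vimage_algebra (space M) A_infty borel"
  have cond: "AE \<omega> in M. real_cond_exp M G X_infty \<omega> = l (A_infty \<omega>)"
    using assms(3) unfolding cond_exp_given_value_def G_def A_infty_def X_infty_def by blast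
  have G: "subalgebra M G"
    unfolding subalgebra_def G_def
    by (auto simp: sets_vimage_algebra2 intro: measurable_sets)
  interpret G: sigma_finite_subalgebra M G
    by (rule finite_measure_subalgebra_is_sigma_finite[unfolded finite_measure_subalgebra_def finite_measure_subalgebra_axioms_def])
      (use G finite_measure_axioms in auto)
  \<comment> \<open>Nonnegativity of \<open>X_infty\<close> passes to its conditional expectation,
    so being nonzero means being positive.\<close>
  have l_pos: "AE \<omega> in M. 0 < l (A_infty \<omega>)"
    using cond G.real_cond_exp_pos[OF X_infty_nonneg X_infty_measurable] assms(4)[folded A_infty_def]
    by eventually_elim simp
  define \<mu> where "\<mu> = distr M borel A_infty"
  interpret \<mu>: real_distribution \<mu>
    unfolding \<mu>_def by (rule real_distribution_distr) simp
  have l_int: "(\<integral>\<^sup>+z. ennreal (l z) * indicator {..y} z \<partial>\<mu>) = (\<integral>\<^sup>+z. ennreal (min z y) \<partial>\<mu>)"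
    if y: "0 \<le> y" for y
  proof -
    define B where "B = {\<omega>\<in>space M. A_infty \<omega> \<le> y}"
    have B: "B \<in> sets G"
    proof -
      have "A_infty -` {..y} \<inter> space M \<in> sets G"
        unfolding G_def by (rule in_vimage_algebra) simp
      moreover have "A_infty -` {..y} \<inter> space M = B" by (auto simp: B_def)
      ultimately show ?thesis by simp
    qed
    then have [measurable]: "B \<in> sets M" using G by (auto simp: subalgebra_def)
    have lB_int: "integrable M (\<lambda>\<omega>. indicator B \<omega> * l (A_infty \<omega>))"
    proof (rule integrable_cong_AE_imp)
      show "integrable M (\<lambda>\<omega>. indicator B \<omega> * real_cond_exp M G X_infty \<omega>)"
        using integrable_mult_indicator[OF \<open>B \<in> sets M\<close> G.real_cond_exp_int(1)[OF X_infty_integrable]] by simp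
      show "AE \<omega> in M. indicator B \<omega> * real_cond_exp M G X_infty \<omega> = indicator B \<omega> * l (A_infty \<omega>)"
        using cond by eventually_elim simp
    qed measurable
    have min_int: "integrable M (\<lambda>\<omega>. min (A_infty \<omega>) y)"
      using A_infty_nonneg y by (intro integrable_const_bound[where B = y]) (auto elim!: eventually_mono simp: min_def)
    \<comment> \<open>\<open>B\<close> depends on \<open>A_infty\<close> only, so on
      \<open>B\<close> the conditional expectation has the same integral as \<open>X_infty\<close>,
      to which \<open>expectation_below_level\<close> applies.\<close>
    have "(\<integral>\<omega>. indicator B \<omega> * l (A_infty \<omega>) \<partial>M) = (\<integral>\<omega>. indicator B \<omega> * real_cond_exp M G X_infty \<omega> \<partial>M)"
      using cond by (intro integral_cong_AE) (auto elim!: eventually_mono)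
    also have "\<dots> = (\<integral>\<omega>. indicator B \<omega> * X_infty \<omega> \<partial>M)"
      using G.real_cond_exp_intA[OF X_infty_integrable B] by (simp add: set_lebesgue_integral_def)
    also have "\<dots> = (\<integral>\<omega>. min (A_infty \<omega>) y \<partial>M)"
      unfolding B_def by (rule expectation_below_level[OF y])
    finally have eq: "(\<integral>\<omega>. indicator B \<omega> * l (A_infty \<omega>) \<partial>M) = (\<integral>\<omega>. min (A_infty \<omega>) y \<partial>M)" .
    have "(\<integral>\<^sup>+z. ennreal (l z) * indicator {..y} z \<partial>\<mu>) = (\<integral>\<^sup>+\<omega>. ennreal (l (A_infty \<omega>)) * indicator {..y} (A_infty \<omega>) \<partial>M)"
      unfolding \<mu>_def by (rule nn_integral_distr) measurable
    also have "\<dots> = (\<integral>\<^sup>+\<omega>. ennreal (indicator B \<omega> * l (A_infty \<omega>)) \<partial>M)"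
      by (rule nn_integral_cong) (auto simp: B_def split: split_indicator)
    also have "\<dots> = ennreal (\<integral>\<omega>. min (A_infty \<omega>) y \<partial>M)"
      unfolding eq[symmetric] using l_pos
      by (intro nn_integral_eq_integral lB_int) (auto elim!: eventually_mono split: split_indicator)
    also have "\<dots> = (\<integral>\<^sup>+\<omega>. ennreal (min (A_infty \<omega>) y) \<partial>M)"
      using A_infty_nonneg y
      by (intro nn_integral_eq_integral[symmetric] min_int) (auto elim!: eventually_mono)
    also have "\<dots> = (\<integral>\<^sup>+z. ennreal (min z y) \<partial>\<mu>)"
      unfolding \<mu>_def by (rule nn_integral_distr[symmetric]) measurable
    finally show ?thesis .
  qed
  have tail: "measure \<mu> {u<..} = measure M {\<omega>\<in>space M. u < A_infty \<omega>}" for u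
    unfolding \<mu>_def by (subst measure_distr) (auto intro!: arg_cong[where f = "measure M"])
  have "measure M {\<omega>\<in>space M. x < A_infty \<omega>} \<noteq> 0"
  proof
    assume zero: "measure M {\<omega>\<in>space M. x < A_infty \<omega>} = 0"
    \<comment> \<open>\<open>upper_end\<close> is defined by the probabilities of u \<le>
      \<open>A_infty\<close> while the claim concerns x < \<open>A_infty\<close>; a point strictly
      between x and the upper end bridges the two.\<close>
    obtain u where u: "ereal x < ereal u" "ereal u < upper_end M A_infty"
      using ereal_dense2[OF assms(6)] unfolding A_infty_def by blast
    have "measure M {\<omega>\<in>space M. u \<le> A_infty \<omega>} \<le> measure M {\<omega>\<in>space M. x < A_infty \<omega>}"
      using u(1) by (intro finite_measure_mono) auto
    then have "measure M {\<omega>\<in>space M. u \<le> A_infty \<omega>} = 0" using zero by (simp add: measure_le_0_iff)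
    then have "upper_end M A_infty \<le> ereal u" unfolding upper_end_def by (intro Inf_lower) blast
    with u(2) show False by simp
  qed
  then have pos: "0 < measure \<mu> {x<..}" unfolding tail by (simp add: zero_less_measure_iff)
  have "AE z in \<mu>. 0 \<le> z" "AE z in \<mu>. 0 < l z"
    unfolding \<mu>_def using A_infty_nonneg l_pos by (simp_all add: AE_distr_iff)
  from \<mu>.survival_eq_exp[OF l this l_int assms(5) pos] show ?thesis
    unfolding tail by (simp add: A_infty_def)
qed

end
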